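(* Let $K\subset\mathbb R^2$ be a convex body with boundary of class $C^2$, and let $\delta\in(0,\mathrm{Vol}_2(K))$. Let $\hat\delta>0$ be the parameter of the dual body of illumination, i.e. such that $\Pi^{\hat\delta}(K)$ is the set of poles $\varphi_K(\ell)$ of the lines $\ell$ containing the chords of flotation of $K$ for $\delta$. If $\Pi_\delta(K)$, $\Gamma_\delta(K)$ and $\Pi^{\hat\delta}(K)$ are pairwise homothetic (possibly with respect to different centers), then $K$ is an ellipse.
   Context: A convex body is a compact convex set with non-empty interior. For each unit vector $\boldsymbol\xi$ let $H_{\boldsymbol\xi}$ be the line orthogonal to $\boldsymbol\xi$ such that the half-plane $H_{\boldsymbol\xi}^-$ cuts off from $K$ area exactly $\delta$; the segments $K\cap H_{\boldsymbol\xi}$ are the chords of flotation, $\Pi_\delta(K)$ is the envelope of the lines $H_{\boldsymbol\xi}$, and $\Gamma_\delta(K)$ is the locus of the centroids of $K\cap H_{\boldsymbol\xi}^-$. For $\hat\delta>0$, $\Pi^{\hat\delta}(K)$ is the set of points $p\notin K$ such that $\mathrm{Conv}(K\cup\{p\})\setminus K$ has area $\hat\delta$. For a line $\ell$ meeting the interior of $K$, its pole $\varphi_K(\ell)$ is the intersection of the lines tangent to $\partial K$ at the two points of $\ell\cap\partial K$. Two curves are homothetic if one is the image of the other under a map $x\mapsto q+\lambda(x-q)$ with $\lambda>0$. *)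

theory Defs
  imports "HOL-Analysis.Analysis"
begin

type_synonym pt = "real^2"

definition area :: "pt set \<Rightarrow> real" where
  "area S = measure lebesgue S"

definition convex_body :: "pt set \<Rightarrow> bool" where
  "convex_body K \<longleftrightarrow> compact K \<and> convex K \<and> interior K \<noteq> {}"

definition C2_boundary :: "pt set \<Rightarrow> bool" where
  "C2_boundary K \<longleftrightarrow> (\<exists>(\<gamma>::real \<Rightarrow> pt) \<gamma>1 \<gamma>2 L. L > 0 \<and>
      (\<forall>s. \<gamma> (s + L) = \<gamma> s) \<and>
      (\<forall>s. (\<gamma> has_vector_derivative \<gamma>1 s) (at s)) \<and>
      (\<forall>s. (\<gamma>1 has_vector_derivative \<gamma>2 s) (at s)) \<and>
      continuous_on UNIV \<gamma>2 \<and>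
      (\<forall>s. \<gamma>1 s \<noteq> 0) \<and>
      inj_on \<gamma> {0..<L} \<and>
      \<gamma> ` {0..L} = frontier K)"

definition dir :: "real \<Rightarrow> pt" where
  "dir \<theta> = vector [cos \<theta>, sin \<theta>]"

definition cap :: "pt \<Rightarrow> real \<Rightarrow> pt set" where
  "cap \<xi> t = {x. \<xi> \<bullet> x \<ge> t}"

definition flot_level :: "pt set \<Rightarrow> real \<Rightarrow> pt \<Rightarrow> real" where
  "flot_level K \<delta> \<xi> = (THE t. area (K \<inter> cap \<xi> t) = \<delta>)"

definition flot_line :: "pt set \<Rightarrow> real \<Rightarrow> pt \<Rightarrow> pt set" where
  "flot_line K \<delta> \<xi> = {x. \<xi> \<bullet> x = flot_level K \<delta> \<xi>}"

definition floating_envelope :: "pt set \<Rightarrow> real \<Rightarrow> pt set" where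
  "floating_envelope K \<delta> = {x. \<exists>\<theta>.
      dir \<theta> \<bullet> x = flot_level K \<delta> (dir \<theta>) \<and>
      vector_derivative dir (at \<theta>) \<bullet> x = deriv (\<lambda>\<phi>. flot_level K \<delta> (dir \<phi>)) \<theta>}"

definition centroid :: "pt set \<Rightarrow> pt" where
  "centroid S = (1 / area S) *\<^sub>R integral S (\<lambda>x. x)"

definition centroid_curve :: "pt set \<Rightarrow> real \<Rightarrow> pt set" where
  "centroid_curve K \<delta> = {centroid (K \<inter> cap \<xi> (flot_level K \<delta> \<xi>)) | \<xi>. norm \<xi> = 1}"

definition illumination_curve :: "pt set \<Rightarrow> real \<Rightarrow> pt set" where
  "illumination_curve K d = {p. p \<notin> K \<and> area (convex hull (insert p K) - K) = d}"

text \<open>Tangent line to boundary at q (for a C^1 boundary the supporting line at q is unique).\<close>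
definition tangent_line :: "pt set \<Rightarrow> pt \<Rightarrow> pt set" where
  "tangent_line K q = {x. \<exists>u. u \<noteq> 0 \<and> (\<forall>y\<in>K. u \<bullet> (y - q) \<le> 0) \<and> u \<bullet> (x - q) = 0}"

definition is_pole :: "pt set \<Rightarrow> pt set \<Rightarrow> pt \<Rightarrow> bool" where
  "is_pole K l p \<longleftrightarrow> (\<forall>q \<in> l \<inter> frontier K. p \<in> tangent_line K q)"

definition homothetic :: "pt set \<Rightarrow> pt set \<Rightarrow> bool" where
  "homothetic A B \<longleftrightarrow> (\<exists>q (c::real). c > 0 \<and> B = (\<lambda>x. q + c *\<^sub>R (x - q)) ` A)"

definition is_ellipse :: "pt set \<Rightarrow> bool" where
  "is_ellipse K \<longleftrightarrow> (\<exists>f c. linear f \<and> inj f \<and> K = (\<lambda>x. c + f x) ` cball (0::pt) 1)"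

end

theory Submission
  imports Defs
begin

text \<open>
  Let \<open>n = dir \<theta>\<close> and \<open>u = n'\<close>, let \<open>h \<theta>\<close> be the level of the line of flotation with normal \<open>n\<close>,
  \<open>a\<close> the half-length of its chord and \<open>y\<close> the height of the pole over it. By Dupin, \<open>h n + h' u\<close> is
  the midpoint of the chord, so the envelope is the curve of midpoints; following the endpoints along
  the boundary gives its radius of curvature, \<open>h + h'' = a\<^sup>2 / y\<close>. In particular \<open>y\<close> has a constant
  sign, and exchanging the two sides of the lines we may assume \<open>y > 0\<close>. The triangle spanned
  by the chord and the pole consists of the cap and the illuminated region, so its area \<open>a y\<close> is a
  constant \<open>k\<close>; comparing with the triangles over the same chord with other apexes shows that
  \<open>h + y\<close> is the support function of the illumination curve. A homothety of ratio \<open>c\<close> taking the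
  envelope to the illumination curve therefore gives \<open>y = (c - 1) h + \<langle>w, n\<rangle>\<close> for a fixed vector \<open>w\<close>,
  whence \<open>y'' + y = (c - 1) k\<^sup>2 / y\<^sup>3\<close>. This Ermakov equation makes \<open>y\<^sup>2\<close> a positive definite quadratic
  form in \<open>n\<close>, and then the endpoints of the chords run through an ellipse.
\<close>

section \<open>Areas of caps and the level of flotation\<close>

text \<open>\<open>h\<close> and the endpoints of the chords are only implicitly defined, so they
  are differentiated by comparison: through areas of rotated caps for \<open>h\<close>, and through
  the supporting lines at the old and the new endpoint for \<open>bp\<close> and \<open>bm\<close>.
  The smoothness of the boundary enters as uniqueness, hence continuity, of its outer unit normal.
  The ratio c is not 1: otherwise y = <w, n> would be odd under n -> -n, against y > 0. So c - 1 can
  be divided by, and y determines h and with it the chords. The ellipse arises as follows. Let S be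
  the symmetric matrix with y^2 = <n, S n>; then y^2 n + y y' u = S n. Because a y = k, the endpoint
  P = h n + (h' + a) u satisfies (c - 1) y (P - m) = S n + (c - 1) k u with a fixed center m. The
  right side is linear in n, since u is n turned by a right angle. As n / y runs over the conic <x,
  S x> = 1, the point P - m runs over a linear image of it.\<close>

definition frame :: "pt \<Rightarrow> pt \<Rightarrow> bool" where
  "frame n u \<longleftrightarrow> n \<bullet> n = 1 \<and> u \<bullet> u = 1 \<and> n \<bullet> u = 0"

lemma inner_pt: "(x::pt) \<bullet> y = x $ 1 * y $ 1 + x $ 2 * y $ 2"
  by (simp add: inner_vec_def sum_2)

lemma pt_eq_iff: "(x::pt) = y \<longleftrightarrow> x $ 1 = y $ 1 \<and> x $ 2 = y $ 2"
  by (simp add: vec_eq_iff forall_2)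

lemma frame_det:
  assumes "frame n u"
  shows "\<bar>n $ 1 * u $ 2 - n $ 2 * u $ 1\<bar> = 1"
proof -
  \<comment> \<open>Lagrange's identity in the plane.\<close>
  have "(n $ 1 * u $ 2 - n $ 2 * u $ 1)\<^sup>2 = (n \<bullet> n) * (u \<bullet> u) - (n \<bullet> u)\<^sup>2"
    unfolding inner_pt by algebra
  then have "(n $ 1 * u $ 2 - n $ 2 * u $ 1)\<^sup>2 = 1"
    using assms by (simp add: frame_def)
  then show ?thesis
    by (metis abs_1 power2_eq_1_iff abs_minus_cancel)
qed

lemma frame_expand:
  assumes "frame n u"
  shows "x = (n \<bullet> x) *\<^sub>R n + (u \<bullet> x) *\<^sub>R u"
proof -
  let ?d = "n $ 1 * u $ 2 - n $ 2 * u $ 1"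
  define w where "w = x - ((n \<bullet> x) *\<^sub>R n + (u \<bullet> x) *\<^sub>R u)"
  have o: "n \<bullet> w = 0" "u \<bullet> w = 0"
    using assms by (auto simp: w_def frame_def inner_diff_right inner_add_right inner_commute)
  have "?d * w $ 1 = u $ 2 * (n \<bullet> w) - n $ 2 * (u \<bullet> w)"
       "?d * w $ 2 = n $ 1 * (u \<bullet> w) - u $ 1 * (n \<bullet> w)"
    unfolding inner_pt by algebra+
  moreover have "?d \<noteq> 0"
    using frame_det[OF assms] by auto
  ultimately have "w = 0"
    using o by (simp add: pt_eq_iff)
  then show ?thesis
    by (simp add: w_def)
qed

text \<open>The orientation of a frame is left open on purpose: by these reflections one estimate
  for a rotating line covers both senses of rotation and both sides of the line.\<close>

lemma frame_uminus: "frame n u \<Longrightarrow> frame (- n) u" "frame n u \<Longrightarrow> frame n (- u)"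
  by (auto simp: frame_def)

lemma frame_norm: "frame n u \<Longrightarrow> norm n = 1" "frame n u \<Longrightarrow> norm u = 1"
  by (auto simp: frame_def norm_eq_sqrt_inner)

section \<open>Areas of triangles, strips and caps\<close>

lemma compact_triangle: "compact (convex hull {a, b, c::pt})"
  by (simp add: compact_convex_hull finite_imp_compact)

text \<open>The determinant of a frame is 1 or -1, and its sign disappears in the absolute
  value.\<close>

lemma area_triangle:
  assumes "frame n u"
  shows "area (convex hull {z, z + a *\<^sub>R n + b *\<^sub>R u, z + c *\<^sub>R n + d *\<^sub>R u}) = \<bar>a * d - b * c\<bar> / 2"
proof -
  let ?d = "n $ 1 * u $ 2 - n $ 2 * u $ 1"
  let ?B = "z + a *\<^sub>R n + b *\<^sub>R u" and ?C = "z + c *\<^sub>R n + d *\<^sub>R u"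
  have "area (convex hull {z, ?B, ?C}) =
      \<bar>(?C $ 1 - z $ 1) * (?B $ 2 - z $ 2) - (?B $ 1 - z $ 1) * (?C $ 2 - z $ 2)\<bar> / 2"
    unfolding area_def by (subst content_triangle[symmetric], rule measure_completion)
      (simp add: borel_compact compact_triangle)
  also have "(?C $ 1 - z $ 1) * (?B $ 2 - z $ 2) - (?B $ 1 - z $ 1) * (?C $ 2 - z $ 2)
      = - (a * d - b * c) * ?d"
    by (simp add: algebra_simps)
  also have "\<bar>- (a * d - b * c) * ?d\<bar> = \<bar>a * d - b * c\<bar>"
    using frame_det[OF assms] by (simp add: abs_mult)
  finally show ?thesis .
qed

lemma area_mono:
  assumes "compact S" "compact T" "S \<subseteq> T"
  shows "area S \<le> area T"
  using assms unfolding area_def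
  by (simp add: measure_mono_fmeasurable lmeasurable_compact fmeasurableD)

lemma area_Un_le:
  assumes "compact S" "compact T"
  shows "area (S \<union> T) \<le> area S + area T"
  using assms unfolding area_def
  by (simp add: measure_Un_le lmeasurable_compact fmeasurableD)

lemma area_Un_negligible:
  assumes "compact S" "compact T" "negligible (S \<inter> T)"
  shows "area (S \<union> T) = area S + area T"
  using assms unfolding area_def
  by (simp add: measure_Un3 lmeasurable_compact negligible_imp_measure0)

lemma compact_Int_cap: "compact K \<Longrightarrow> compact (K \<inter> cap \<xi> t)"
  unfolding cap_def by (intro compact_Int_closed closed_halfspace_ge)

lemma area_complement_cap:
  assumes "compact K" "\<xi> \<noteq> 0"
  shows "area (K \<inter> cap (- \<xi>) (- t)) = area K - area (K \<inter> cap \<xi> t)"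
proof -
  have "negligible ((K \<inter> cap \<xi> t) \<inter> (K \<inter> cap (- \<xi>) (- t)))"
    by (rule negligible_subset[OF negligible_hyperplane[of \<xi> t]])
       (use assms in \<open>auto simp: cap_def\<close>)
  then have "area ((K \<inter> cap \<xi> t) \<union> (K \<inter> cap (- \<xi>) (- t))) =
      area (K \<inter> cap \<xi> t) + area (K \<inter> cap (- \<xi>) (- t))"
    by (intro area_Un_negligible compact_Int_cap assms)
  also have "(K \<inter> cap \<xi> t) \<union> (K \<inter> cap (- \<xi>) (- t)) = K"
    by (auto simp: cap_def)
  finally show ?thesis by simp
qed

text \<open>The strip is enclosed in a single triangle of height \<open>2 d\<close>, whose cross-section at height
  \<open>d\<close> is still wide enough.\<close>
lemma area_strip_le:
  assumes fr: "frame n u" and K: "compact K" and "d > 0" "M > 0" and M: "\<And>x. x \<in> K \<Longrightarrow> norm x \<le> M"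
  shows "area (K \<inter> {x. t \<le> n \<bullet> x \<and> n \<bullet> x \<le> t + d}) \<le> 4 * M * d"
proof -
  \<comment> \<open>The triangle has a base of length \<open>4 * M\<close> at level \<open>t\<close>
    and its apex at level \<open>t + 2 * d\<close>, centered so that at level \<open>t + d\<close>
    it still covers tangential coordinates from \<open>- M\<close> to \<open>M\<close>.\<close>
  define z where "z = t *\<^sub>R n - (2 * M) *\<^sub>R u"
  let ?T = "convex hull {z, z + 0 *\<^sub>R n + (4 * M) *\<^sub>R u, z + (2 * d) *\<^sub>R n + (2 * M) *\<^sub>R u}"
  have "x \<in> ?T" if x: "x \<in> K" "t \<le> n \<bullet> x" "n \<bullet> x \<le> t + d" for x
  proof -
    have s: "\<bar>u \<bullet> x\<bar> \<le> M"
      using Cauchy_Schwarz_ineq2[of u x] M[OF x(1)] frame_norm[OF fr] by simp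
    \<comment> \<open>Barycentric weights: \<open>w\<close> belongs to the apex and \<open>v\<close>
      to the right end of the base.\<close>
    define w where "w = (n \<bullet> x - t) / (2 * d)"
    define v where "v = (u \<bullet> x + 2 * M) / (4 * M) - w / 2"
    have w: "0 \<le> w" "w \<le> 1 / 2"
      using x \<open>d > 0\<close> by (auto simp: w_def divide_simps)
    have v: "1 / 4 - w / 2 \<le> v" "v \<le> 3 / 4 - w / 2"
      using s \<open>M > 0\<close> by (auto simp: v_def field_simps abs_le_iff)
    have e: "n \<bullet> x = t + w * (2 * d)" "u \<bullet> x = v * (4 * M) + w * (2 * M) - 2 * M"
      using \<open>d > 0\<close> \<open>M > 0\<close> by (auto simp: w_def v_def field_simps)
    have "x = (t + w * (2 * d)) *\<^sub>R n + (v * (4 * M) + w * (2 * M) - 2 * M) *\<^sub>R u"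
      using frame_expand[OF fr, of x] unfolding e by simp
    also have "\<dots> = z + v *\<^sub>R (z + 0 *\<^sub>R n + (4 * M) *\<^sub>R u - z)
        + w *\<^sub>R (z + (2 * d) *\<^sub>R n + (2 * M) *\<^sub>R u - z)"
      by (simp add: z_def algebra_simps)
    finally show ?thesis
      unfolding convex_hull_3_alt using v w by (intro CollectI exI[of _ v] exI[of _ w]) auto
  qed
  then have "K \<inter> {x. t \<le> n \<bullet> x \<and> n \<bullet> x \<le> t + d} \<subseteq> ?T" by auto
  moreover have "compact (K \<inter> {x. t \<le> n \<bullet> x \<and> n \<bullet> x \<le> t + d})"
    unfolding Collect_conj_eq
    by (intro compact_Int_closed K closed_Int closed_halfspace_ge closed_halfspace_le)
  ultimately have "area (K \<inter> {x. t \<le> n \<bullet> x \<and> n \<bullet> x \<le> t + d}) \<le> area ?T"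
    by (intro area_mono compact_triangle)
  also have "\<dots> = 4 * M * d"
    using assms by (subst area_triangle[OF fr]) simp
  finally show ?thesis .
qed

lemma frame_exists:
  assumes "norm (\<xi>::pt) = 1"
  shows "frame \<xi> (vector [- \<xi> $ 2, \<xi> $ 1])"
  using assms by (simp add: frame_def norm_eq_sqrt_inner inner_pt)

text \<open>Caps with a common normal differ by a strip, whose area is at most a constant times its
  width; so the area is even Lipschitz in the level.\<close>

lemma continuous_on_area_cap:
  assumes "compact K" "norm \<xi> = 1"
  shows "continuous_on UNIV (\<lambda>t. area (K \<inter> cap \<xi> t))"
proof -
  obtain M where M: "M > 0" "\<And>x. x \<in> K \<Longrightarrow> norm x \<le> M"
    using compact_imp_bounded[OF assms(1)] by (metis bounded_pos)
  have *: "\<bar>area (K \<inter> cap \<xi> t) - area (K \<inter> cap \<xi> s)\<bar> \<le> 4 * M * \<bar>t - s\<bar>" if "t < s" for s t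
  proof -
    let ?S = "K \<inter> {x. t \<le> \<xi> \<bullet> x \<and> \<xi> \<bullet> x \<le> t + (s - t)}"
    have c: "compact ?S"
      unfolding Collect_conj_eq
      by (intro compact_Int_closed assms closed_Int closed_halfspace_ge closed_halfspace_le)
    have "K \<inter> cap \<xi> t \<subseteq> (K \<inter> cap \<xi> s) \<union> ?S"
      by (auto simp: cap_def)
    then have "area (K \<inter> cap \<xi> t) \<le> area (K \<inter> cap \<xi> s) + area ?S"
      using area_mono[OF compact_Int_cap compact_Un[OF compact_Int_cap c]] area_Un_le[OF compact_Int_cap c] assms(1)
      by (meson order_trans)
    moreover have "area ?S \<le> 4 * M * (s - t)"
      using area_strip_le[OF frame_exists[OF assms(2)] assms(1) _ M, of "s - t" t] that by simp
    moreover have "area (K \<inter> cap \<xi> s) \<le> area (K \<inter> cap \<xi> t)"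
      by (rule area_mono) (use assms that in \<open>auto simp: cap_def intro!: compact_Int_closed closed_halfspace_ge\<close>)
    ultimately show ?thesis using that by simp
  qed
  have "\<bar>area (K \<inter> cap \<xi> t) - area (K \<inter> cap \<xi> s)\<bar> \<le> 4 * M * \<bar>t - s\<bar>" for s t
    using *[of s t] *[of t s] by (cases s t rule: linorder_cases) (auto simp: abs_minus_commute)
  then have "(4 * M)-lipschitz_on UNIV (\<lambda>t. area (K \<inter> cap \<xi> t))"
    using M(1) by (intro lipschitz_onI) (auto simp: dist_real_def)
  then show ?thesis
    by (rule lipschitz_on_continuous_on)
qed

lemma area_cap_antimono:
  assumes "compact K" "s \<le> t"
  shows "area (K \<inter> cap \<xi> t) \<le> area (K \<inter> cap \<xi> s)"
  by (rule area_mono) (use assms in \<open>auto simp: cap_def intro!: compact_Int_closed closed_halfspace_ge\<close>)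

text \<open>The hypotheses on the areas provide points of \<open>K\<close> at or above level
  \<open>t\<close> and below level \<open>s\<close>. Since the interior is dense in \<open>K\<close>
  and connected, it meets the open strip between the levels, and the nonempty open intersection has
  positive area.\<close>

lemma area_cap_strict_antimono:
  assumes K: "convex_body K" and "s < t"
    and "0 < area (K \<inter> cap \<xi> t)" "area (K \<inter> cap \<xi> s) < area K"
  shows "area (K \<inter> cap \<xi> t) < area (K \<inter> cap \<xi> s)"
proof -
  have cK: "compact K" "convex K" "interior K \<noteq> {}"
    using K by (auto simp: convex_body_def)
  have cl: "closure (interior K) = K"
    using cK by (simp add: convex_closure_interior compact_imp_closed closure_closed)
  have "K \<inter> cap \<xi> t \<noteq> {}"
    using assms(3) by (auto simp: area_def)
  then obtain y where y: "y \<in> K" "\<xi> \<bullet> y \<ge> t" by (auto simp: cap_def)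
  obtain x where x: "x \<in> K" "\<xi> \<bullet> x < s"
  proof -
    have "K \<inter> cap \<xi> s \<noteq> K" using assms(4) by auto
    then show ?thesis using that by (fastforce simp: cap_def not_le)
  qed
  have "\<exists>y'\<in>interior K. \<xi> \<bullet> y' > s"
  proof (rule ccontr)
    assume "\<not> ?thesis"
    then have "interior K \<subseteq> {x. \<xi> \<bullet> x \<le> s}" by (auto simp: not_less)
    then have "K \<subseteq> {x. \<xi> \<bullet> x \<le> s}"
      using closure_minimal[OF _ closed_halfspace_le] cl by metis
    then show False using y \<open>s < t\<close> by auto
  qed
  then obtain y' where y': "y' \<in> interior K" "\<xi> \<bullet> y' > s" by blast
  have "\<exists>x'\<in>interior K. \<xi> \<bullet> x' < s"
  proof (rule ccontr)
    assume "\<not> ?thesis"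
    then have "interior K \<subseteq> {x. \<xi> \<bullet> x \<ge> s}" by (auto simp: not_less)
    then have "K \<subseteq> {x. \<xi> \<bullet> x \<ge> s}"
      using closure_minimal[OF _ closed_halfspace_ge] cl by metis
    then show False using x by auto
  qed
  then obtain x' where x': "x' \<in> interior K" "\<xi> \<bullet> x' < s" by blast
  have "connected ((\<lambda>x. \<xi> \<bullet> x) ` interior K)"
    by (intro connected_continuous_image continuous_intros convex_connected convex_interior cK)
  then have iv: "is_interval ((\<lambda>x. \<xi> \<bullet> x) ` interior K)"
    by (simp add: is_interval_connected_1)
  \<comment> \<open>A level strictly between \<open>s\<close> and \<open>t\<close> which does not
    exceed that of \<open>y'\<close>, so that it is attained between \<open>x'\<close> and
    \<open>y'\<close>.\<close>
  define c where "c = min ((s + t) / 2) (\<xi> \<bullet> y')"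
  have "c \<in> (\<lambda>x. \<xi> \<bullet> x) ` interior K"
    by (rule mem_is_interval_1_I[OF iv imageI[OF x'(1)] imageI[OF y'(1)]])
       (use \<open>s < t\<close> x' y' in \<open>auto simp: c_def min_def\<close>)
  then obtain w where w: "w \<in> interior K" "\<xi> \<bullet> w = c" by auto
  have c: "s < c" "c < t" using \<open>s < t\<close> y' by (auto simp: c_def min_def)
  define U where "U = interior K \<inter> {x. \<xi> \<bullet> x > s} \<inter> {x. \<xi> \<bullet> x < t}"
  have "open U" unfolding U_def
    by (intro open_Int open_interior open_halfspace_gt open_halfspace_lt)
  moreover have "U \<noteq> {}" using w c by (auto simp: U_def)
  ultimately have nU: "\<not> negligible U" by (simp add: open_not_negligible)
  have sub: "K \<inter> cap \<xi> t \<subseteq> K \<inter> cap \<xi> s" using \<open>s < t\<close> by (auto simp: cap_def)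
  have meas: "K \<inter> cap \<xi> t \<in> lmeasurable" "K \<inter> cap \<xi> s \<in> lmeasurable"
    using cK by (auto intro!: lmeasurable_compact compact_Int_cap)
  have "area ((K \<inter> cap \<xi> s) - (K \<inter> cap \<xi> t)) = area (K \<inter> cap \<xi> s) - area (K \<inter> cap \<xi> t)"
    unfolding area_def by (rule measurable_measure_Diff) (use meas sub in auto)
  moreover have "area ((K \<inter> cap \<xi> s) - (K \<inter> cap \<xi> t)) \<noteq> 0"
  proof
    assume "area ((K \<inter> cap \<xi> s) - (K \<inter> cap \<xi> t)) = 0"
    moreover have "(K \<inter> cap \<xi> s) - (K \<inter> cap \<xi> t) \<in> lmeasurable"
      using meas by (intro fmeasurable.Diff) auto
    ultimately have "negligible ((K \<inter> cap \<xi> s) - (K \<inter> cap \<xi> t))"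
      by (simp add: area_def negligible_iff_measure)
    moreover have "U \<subseteq> (K \<inter> cap \<xi> s) - (K \<inter> cap \<xi> t)"
      using interior_subset by (auto simp: U_def cap_def)
    ultimately show False using nU negligible_subset by blast
  qed
  moreover have "area (K \<inter> cap \<xi> t) \<le> area (K \<inter> cap \<xi> s)"
    using area_cap_antimono[OF cK(1)] \<open>s < t\<close> by simp
  ultimately show ?thesis by linarith
qed

text \<open>This makes the definite description in \<open>flot_level\<close> meaningful: existence
  by the intermediate value theorem, uniqueness by strict monotonicity, which applies because
  \<open>\<delta>\<close> is neither zero nor the full area.\<close>

lemma ex1_flot_level:
  assumes K: "convex_body K" and \<delta>: "0 < \<delta>" "\<delta> < area K" and \<xi>: "norm \<xi> = 1"
  shows "\<exists>!t. area (K \<inter> cap \<xi> t) = \<delta>"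
proof (rule ex_ex1I)
  have cK: "compact K" using K by (auto simp: convex_body_def)
  obtain M where M: "M > 0" "\<And>x. x \<in> K \<Longrightarrow> norm x \<le> M"
    using compact_imp_bounded[OF cK] by (metis bounded_pos)
  have M': "\<bar>\<xi> \<bullet> x\<bar> \<le> M" if "x \<in> K" for x
    using Cauchy_Schwarz_ineq2[of \<xi> x] M(2)[OF that] \<xi> by simp
  have "K \<inter> cap \<xi> (- M) = K" using M' by (force simp: cap_def)
  \<comment> \<open>At level \<open>M\<close> itself the line may still touch \<open>K\<close>; at
    \<open>M + 1\<close> the cap is certainly empty.\<close>
  moreover have "K \<inter> cap \<xi> (M + 1) = {}" using M' by (force simp: cap_def)
  ultimately have "area (K \<inter> cap \<xi> (M + 1)) \<le> \<delta>" "\<delta> \<le> area (K \<inter> cap \<xi> (- M))"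
    using \<delta> by (auto simp: area_def)
  moreover have "continuous_on {- M..M + 1} (\<lambda>t. area (K \<inter> cap \<xi> t))"
    using continuous_on_area_cap[OF cK \<xi>] continuous_on_subset by blast
  ultimately show "\<exists>t. area (K \<inter> cap \<xi> t) = \<delta>"
    using IVT2'[of "\<lambda>t. area (K \<inter> cap \<xi> t)" "M + 1" \<delta> "- M"] M(1) by auto
next
  fix s t assume "area (K \<inter> cap \<xi> s) = \<delta>" "area (K \<inter> cap \<xi> t) = \<delta>"
  then show "s = t"
    using area_cap_strict_antimono[OF K, of s t \<xi>] area_cap_strict_antimono[OF K, of t s \<xi>] \<delta>
    by (cases s t rule: linorder_cases) auto
qed

lemma area_flot_level:
  assumes "convex_body K" "0 < \<delta>" "\<delta> < area K" "norm \<xi> = 1"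
  shows "area (K \<inter> cap \<xi> (flot_level K \<delta> \<xi>)) = \<delta>"
  unfolding flot_level_def by (rule theI') (rule ex1_flot_level[OF assms])

lemma flot_level_eqI:
  assumes "convex_body K" "0 < \<delta>" "\<delta> < area K" "norm \<xi> = 1" "area (K \<inter> cap \<xi> t) = \<delta>"
  shows "flot_level K \<delta> \<xi> = t"
  unfolding flot_level_def using ex1_flot_level[OF assms(1-4)] assms(5) by auto

text \<open>Comparison principle: areas fall as the level rises, so a trial line that cuts off too
  little lies beyond the line of flotation. With its mirror image it bounds the level without
  computing it.\<close>

lemma flot_level_lessI:
  assumes "convex_body K" "0 < \<delta>" "\<delta> < area K" "norm \<xi> = 1" "area (K \<inter> cap \<xi> t) < \<delta>"
  shows "flot_level K \<delta> \<xi> < t"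
proof (rule ccontr)
  assume "\<not> ?thesis"
  then have "area (K \<inter> cap \<xi> (flot_level K \<delta> \<xi>)) \<le> area (K \<inter> cap \<xi> t)"
    using assms(1) by (intro area_cap_antimono) (auto simp: convex_body_def)
  then show False using area_flot_level[OF assms(1-4)] assms(5) by simp
qed

lemma flot_level_gtI:
  assumes "convex_body K" "0 < \<delta>" "\<delta> < area K" "norm \<xi> = 1" "\<delta> < area (K \<inter> cap \<xi> t)"
  shows "t < flot_level K \<delta> \<xi>"
proof (rule ccontr)
  assume "\<not> ?thesis"
  then have "area (K \<inter> cap \<xi> t) \<le> area (K \<inter> cap \<xi> (flot_level K \<delta> \<xi>))"
    using assms(1) by (intro area_cap_antimono) (auto simp: convex_body_def)
  then show False using area_flot_level[OF assms(1-4)] assms(5) by simp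
qed

text \<open>Complementary caps are bounded by the same line. This is the basis for exchanging the
  two sides.\<close>

lemma flot_level_uminus:
  assumes "convex_body K" "0 < \<delta>" "\<delta> < area K" "norm \<xi> = 1"
  shows "flot_level K (area K - \<delta>) (- \<xi>) = - flot_level K \<delta> \<xi>"
proof (rule flot_level_eqI)
  show "area (K \<inter> cap (- \<xi>) (- flot_level K \<delta> \<xi>)) = area K - \<delta>"
    using assms area_flot_level[OF assms]
    by (subst area_complement_cap) (auto simp: convex_body_def)
qed (use assms in auto)

text \<open>Otherwise, by connectedness, the interior lies on one side of the line, and so does its
  closure \<open>K\<close>; the cap then has area zero or the full area.\<close>

lemma flot_line_meets_interior:
  assumes K: "convex_body K" and \<delta>: "0 < \<delta>" "\<delta> < area K" and \<xi>: "norm \<xi> = 1"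
  shows "\<exists>x\<in>interior K. \<xi> \<bullet> x = flot_level K \<delta> \<xi>"
proof (rule ccontr)
  assume no: "\<not> ?thesis"
  let ?h = "flot_level K \<delta> \<xi>"
  have cK: "compact K" "convex K" "interior K \<noteq> {}"
    using K by (auto simp: convex_body_def)
  have cl: "closure (interior K) = K"
    using cK by (simp add: convex_closure_interior compact_imp_closed closure_closed)
  have "connected ((\<lambda>x. \<xi> \<bullet> x) ` interior K)"
    by (intro connected_continuous_image continuous_intros convex_connected convex_interior cK)
  then have iv: "is_interval ((\<lambda>x. \<xi> \<bullet> x) ` interior K)"
    by (simp add: is_interval_connected_1)
  have "interior K \<subseteq> {x. \<xi> \<bullet> x \<le> ?h} \<or> interior K \<subseteq> {x. \<xi> \<bullet> x \<ge> ?h}"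
  proof (rule ccontr)
    assume "\<not> ?thesis"
    then obtain x y where "x \<in> interior K" "\<xi> \<bullet> x > ?h" "y \<in> interior K" "\<xi> \<bullet> y < ?h"
      by (auto simp: subset_iff not_le)
    then have "?h \<in> (\<lambda>x. \<xi> \<bullet> x) ` interior K"
      using mem_is_interval_1_I[OF iv imageI imageI, of y x ?h] by auto
    then show False using no by auto
  qed
  then have "K \<subseteq> {x. \<xi> \<bullet> x \<le> ?h} \<or> K \<subseteq> {x. \<xi> \<bullet> x \<ge> ?h}"
    using closure_minimal[OF _ closed_halfspace_le] closure_minimal[OF _ closed_halfspace_ge] cl
    by metis
  then show False
  proof
    assume "K \<subseteq> {x. \<xi> \<bullet> x \<le> ?h}"
    then have "K \<inter> cap \<xi> ?h \<subseteq> {x. \<xi> \<bullet> x = ?h}" by (auto simp: cap_def)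
    then have "negligible (K \<inter> cap \<xi> ?h)"
      using negligible_hyperplane[of \<xi> ?h] negligible_subset \<xi> by (metis norm_zero zero_neq_one)
    then show False
      using area_flot_level[OF assms] \<delta> by (simp add: area_def negligible_imp_measure0)
  next
    assume "K \<subseteq> {x. \<xi> \<bullet> x \<ge> ?h}"
    then have "K \<inter> cap \<xi> ?h = K" by (auto simp: cap_def)
    then show False
      using area_flot_level[OF assms] \<delta> by simp
  qed
qed

section \<open>Rotating a line, chords and normals\<close>

text \<open>Seen from \<open>z\<close>, the chord is longer towards \<open>- u\<close> than towards
  \<open>u\<close>. Tilting the normal towards \<open>u\<close> gains at most a triangle of area
  \<open>r * r * \<tau> / 2\<close> on the short side and loses at least one of area
  \<open>R * R * \<tau> / 2\<close> on the long side.\<close>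

lemma slope_decreases_area:
  assumes fr: "frame n u" and K: "compact K" "convex K" "z \<in> K" and r: "0 < r" "r < R"
    and inside: "z - R *\<^sub>R u \<in> interior K" and outside: "z + r *\<^sub>R u \<notin> K"
  obtains c where "c > 0" and
    "\<And>\<tau>. 0 < \<tau> \<Longrightarrow> \<tau> < c \<Longrightarrow>
      area (K \<inter> cap (n + \<tau> *\<^sub>R u) ((n + \<tau> *\<^sub>R u) \<bullet> z)) < area (K \<inter> cap n (n \<bullet> z))"
proof -
  have fr': "n \<bullet> n = 1" "u \<bullet> u = 1" "n \<bullet> u = 0" "u \<bullet> n = 0" "norm n = 1"
    using fr frame_norm[OF fr] by (auto simp: frame_def inner_commute)
  obtain e where e: "e > 0" "ball (z - R *\<^sub>R u) e \<subseteq> K"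
    using inside by (auto simp: mem_interior)
  have "open (- K)" using K(1) by (simp add: compact_imp_closed open_Compl)
  then obtain e' where e': "e' > 0" "ball (z + r *\<^sub>R u) e' \<subseteq> - K"
    using outside by (meson ComplI open_contains_ball)
  have "R > 0" using r by simp
  show thesis
  \<comment> \<open>The tilted line leaves the chord by \<open>R * \<tau>\<close> and
    \<open>r * \<tau>\<close> at the two test points; these distances must stay within the balls
    inside and outside \<open>K\<close>.\<close>
  proof (rule that[of "min (e / R) (e' / r)"])
    show "0 < min (e / R) (e' / r)" using e e' r \<open>R > 0\<close> by simp
    fix \<tau> :: real assume \<tau>: "0 < \<tau>" "\<tau> < min (e / R) (e' / r)"
    then have small: "R * \<tau> < e" "r * \<tau> < e'"
      using r \<open>R > 0\<close> by (simp_all add: pos_less_divide_eq mult.commute)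
    define w where "w = n + \<tau> *\<^sub>R u"
    define Tg where "Tg = convex hull {z, z + 0 *\<^sub>R n + r *\<^sub>R u, z + (- r * \<tau>) *\<^sub>R n + r *\<^sub>R u}"
    define Tl where "Tl = convex hull {z, z + 0 *\<^sub>R n + (- R) *\<^sub>R u, z + (R * \<tau>) *\<^sub>R n + (- R) *\<^sub>R u}"
    have Tl_K: "Tl \<subseteq> K"
      unfolding Tl_def
    proof (rule hull_minimal)
      have "z + (R * \<tau>) *\<^sub>R n + (- R) *\<^sub>R u \<in> ball (z - R *\<^sub>R u) e"
        using small \<tau> \<open>R > 0\<close> fr' by (simp add: dist_norm)
      moreover have "z + 0 *\<^sub>R n + (- R) *\<^sub>R u \<in> ball (z - R *\<^sub>R u) e"
        using e by simp
      ultimately show "{z, z + 0 *\<^sub>R n + (- R) *\<^sub>R u, z + (R * \<tau>) *\<^sub>R n + (- R) *\<^sub>R u} \<subseteq> K"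
        using K(3) e by blast
    qed (use K in auto)
    have Tl_n: "Tl \<subseteq> cap n (n \<bullet> z)"
      unfolding Tl_def
      by (rule hull_minimal)
         (use fr' \<tau> \<open>R > 0\<close> in \<open>auto simp: cap_def inner_add_right inner_diff_right convex_halfspace_ge\<close>)
    have Tl_w: "Tl \<subseteq> {x. w \<bullet> x \<le> w \<bullet> z}"
      unfolding Tl_def
    proof (rule hull_minimal)
      show "convex {x. w \<bullet> x \<le> w \<bullet> z}" by (rule convex_halfspace_le)
    qed (use fr' \<tau> \<open>R > 0\<close> in
        \<open>auto simp: w_def inner_add_right inner_diff_right inner_add_left algebra_simps\<close>)
    have "x \<in> (K \<inter> cap n (n \<bullet> z)) \<union> Tg" if x: "x \<in> K" "w \<bullet> x \<ge> w \<bullet> z" for x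
    proof (cases "n \<bullet> x \<ge> n \<bullet> z")
      case False
      define v where "v = n \<bullet> (x - z)"
      define s where "s = u \<bullet> (x - z)"
      have xe: "x = z + v *\<^sub>R n + s *\<^sub>R u"
        using frame_expand[OF fr, of "x - z"] by (simp add: v_def s_def algebra_simps)
      have v: "v < 0" "v + \<tau> * s \<ge> 0"
        using False x(2) by (auto simp: v_def s_def w_def inner_diff_right inner_add_left algebra_simps)
      then have s: "s > 0" using \<tau> by (smt (verit) mult_nonneg_nonpos)
      \<comment> \<open>A gained point farther out than \<open>r\<close> could be shrunk towards
        \<open>z\<close> to tangential coordinate \<open>r\<close>. The result would lie in
        \<open>K\<close> by convexity, but also in the ball around \<open>z + r *\<^sub>R u\<close>
        that misses \<open>K\<close>.\<close>
      have "s \<le> r"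
      proof (rule ccontr)
        assume "\<not> s \<le> r"
        then have sr: "s > r" by simp
        have "z + (r / s) *\<^sub>R (x - z) \<in> K"
        proof -
          have "(1 - r / s) *\<^sub>R z + (r / s) *\<^sub>R x \<in> K"
            by (rule convexD_alt[OF K(2,3) x(1)]) (use r s sr in auto)
          then show ?thesis by (simp add: algebra_simps)
        qed
        moreover have "z + (r / s) *\<^sub>R (x - z) \<in> ball (z + r *\<^sub>R u) e'"
        proof -
          have "z + (r / s) *\<^sub>R (x - z) = z + r *\<^sub>R u + (r / s * v) *\<^sub>R n"
            using s by (simp add: xe algebra_simps)
          then have "dist (z + r *\<^sub>R u) (z + (r / s) *\<^sub>R (x - z)) = r / s * \<bar>v\<bar>"
            using fr' r s by (simp add: dist_norm abs_mult)
          also have "\<dots> \<le> r / s * (\<tau> * s)"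
            using v r s by (intro mult_left_mono) auto
          also have "\<dots> < e'" using small s by simp
          finally show ?thesis by simp
        qed
        ultimately show False using e' by blast
      qed
      define q where "q = - v / (r * \<tau>)"
      have q: "0 \<le> q" "q \<le> s / r"
        using v r \<tau> by (auto simp: q_def field_simps)
      have "x = z + (s / r - q) *\<^sub>R (z + 0 *\<^sub>R n + r *\<^sub>R u - z) + q *\<^sub>R (z + (- r * \<tau>) *\<^sub>R n + r *\<^sub>R u - z)"
      proof -
        have "v = - (q * r * \<tau>)" using r \<tau> by (simp add: q_def)
        then have "x = z + (- (q * r * \<tau>)) *\<^sub>R n + s *\<^sub>R u" using xe by simp
        also have "\<dots> = z + (s / r - q) *\<^sub>R (z + 0 *\<^sub>R n + r *\<^sub>R u - z) + q *\<^sub>R (z + (- r * \<tau>) *\<^sub>R n + r *\<^sub>R u - z)"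
          using r by (simp add: algebra_simps)
        finally show ?thesis .
      qed
      then have "x \<in> Tg"
        unfolding Tg_def convex_hull_3_alt using q \<open>s \<le> r\<close> r
        by (intro CollectI exI[of _ "s / r - q"] exI[of _ q]) auto
      then show ?thesis by simp
    qed (use x in \<open>auto simp: cap_def\<close>)
    \<comment> \<open>The lost triangle \<open>Tl\<close> is in the old cap and meets the new one in
      a null set, so this inclusion compares the four areas without an exact description of the
      gained and lost regions.\<close>
    then have "(K \<inter> cap w (w \<bullet> z)) \<union> Tl \<subseteq> (K \<inter> cap n (n \<bullet> z)) \<union> Tg"
      using Tl_K Tl_n by (auto simp: cap_def)
    moreover have comp: "compact Tl" "compact Tg"
      by (auto simp: Tl_def Tg_def compact_triangle)
    ultimately have "area ((K \<inter> cap w (w \<bullet> z)) \<union> Tl) \<le> area ((K \<inter> cap n (n \<bullet> z)) \<union> Tg)"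
      by (intro area_mono compact_Un compact_Int_cap K(1))
    also have "\<dots> \<le> area (K \<inter> cap n (n \<bullet> z)) + area Tg"
      by (intro area_Un_le compact_Int_cap K(1) comp)
    finally have 1: "area ((K \<inter> cap w (w \<bullet> z)) \<union> Tl) \<le> area (K \<inter> cap n (n \<bullet> z)) + area Tg" .
    have "w \<noteq> 0"
    proof
      assume "w = 0"
      then have "n \<bullet> w = 0" by simp
      then show False using fr' by (simp add: w_def inner_add_right)
    qed
    then have "negligible ((K \<inter> cap w (w \<bullet> z)) \<inter> Tl)"
      using Tl_w by (intro negligible_subset[OF negligible_hyperplane[of w "w \<bullet> z"]]) (auto simp: cap_def)
    then have 2: "area ((K \<inter> cap w (w \<bullet> z)) \<union> Tl) = area (K \<inter> cap w (w \<bullet> z)) + area Tl"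
      by (intro area_Un_negligible compact_Int_cap K(1) comp)
    have "area Tg = r * r * \<tau> / 2" "area Tl = R * R * \<tau> / 2"
      unfolding Tg_def Tl_def area_triangle[OF fr] using r \<tau> by (auto simp: abs_mult)
    moreover have "r * r < R * R" using r by (intro mult_strict_mono) auto
    then have "r * r * \<tau> / 2 < R * R * \<tau> / 2" using \<tau> by simp
    ultimately show "area (K \<inter> cap (n + \<tau> *\<^sub>R u) ((n + \<tau> *\<^sub>R u) \<bullet> z)) < area (K \<inter> cap n (n \<bullet> z))"
      using 1 2 unfolding w_def by linarith
  qed
qed

text \<open>The rotated normal is a positive multiple of
  \<open>n + tan \<epsilon> *\<^sub>R u\<close>, and a positive factor does not change the
  cap.\<close>

lemma rotation_decreases_area:
  assumes "frame n u" "compact K" "convex K" "z \<in> K" "0 < r" "r < R"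
    and "z - R *\<^sub>R u \<in> interior K" "z + r *\<^sub>R u \<notin> K"
  obtains e where "e > 0" and
    "\<And>\<epsilon>. 0 < \<epsilon> \<Longrightarrow> \<epsilon> < e \<Longrightarrow>
      area (K \<inter> cap (cos \<epsilon> *\<^sub>R n + sin \<epsilon> *\<^sub>R u) ((cos \<epsilon> *\<^sub>R n + sin \<epsilon> *\<^sub>R u) \<bullet> z))
      < area (K \<inter> cap n (n \<bullet> z))"
proof -
  obtain c where c: "c > 0" and less: "\<And>\<tau>. 0 < \<tau> \<Longrightarrow> \<tau> < c \<Longrightarrow>
      area (K \<inter> cap (n + \<tau> *\<^sub>R u) ((n + \<tau> *\<^sub>R u) \<bullet> z)) < area (K \<inter> cap n (n \<bullet> z))"
    using slope_decreases_area[OF assms] by blast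
  show thesis
  proof (rule that[of "arctan c"])
    show "0 < arctan c" using c by simp
    fix \<epsilon> assume \<epsilon>: "0 < \<epsilon>" "\<epsilon> < arctan c"
    have lt: "\<epsilon> < pi / 2" using \<epsilon> arctan_ubound[of c] by linarith
    have cos: "cos \<epsilon> > 0" using \<epsilon> lt by (intro cos_gt_zero_pi) auto
    have "tan \<epsilon> < tan (arctan c)"
      using \<epsilon> arctan_ubound[of c] by (intro tan_monotone) auto
    then have t: "0 < tan \<epsilon>" "tan \<epsilon> < c"
      using \<epsilon> lt by (auto simp: tan_gt_zero tan_arctan)
    have eq: "cos \<epsilon> *\<^sub>R n + sin \<epsilon> *\<^sub>R u = cos \<epsilon> *\<^sub>R (n + tan \<epsilon> *\<^sub>R u)"
      using cos by (simp add: tan_def algebra_simps)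
    have "cap (cos \<epsilon> *\<^sub>R n + sin \<epsilon> *\<^sub>R u) ((cos \<epsilon> *\<^sub>R n + sin \<epsilon> *\<^sub>R u) \<bullet> z)
        = cap (n + tan \<epsilon> *\<^sub>R u) ((n + tan \<epsilon> *\<^sub>R u) \<bullet> z)"
      unfolding eq cap_def using cos by simp
    then show "area (K \<inter> cap (cos \<epsilon> *\<^sub>R n + sin \<epsilon> *\<^sub>R u) ((cos \<epsilon> *\<^sub>R n + sin \<epsilon> *\<^sub>R u) \<bullet> z))
      < area (K \<inter> cap n (n \<bullet> z))"
      using less[OF t] by simp
  qed
qed

section \<open>Exit points of lines through a convex body\<close>

definition reach :: "pt set \<Rightarrow> pt \<Rightarrow> pt \<Rightarrow> real" where
  "reach K z w = Sup {s. z + s *\<^sub>R w \<in> K}"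

text \<open>The base point \<open>z\<close> need not belong to \<open>K\<close>, as it will be the
  foot of the perpendicular from the origin; the parameter \<open>s0\<close> of an interior point
  takes its place, and \<open>reach\<close> may be negative. Up to the exit point the line stays in
  the interior, as a segment of a convex set starting at an interior point does.\<close>

lemma reach_props:
  assumes K: "compact K" "convex K" and w: "w \<noteq> 0" and s0: "z + s0 *\<^sub>R w \<in> interior K"
  shows reach_mem: "z + reach K z w *\<^sub>R w \<in> K"
    and le_reach: "\<And>s. z + s *\<^sub>R w \<in> K \<Longrightarrow> s \<le> reach K z w"
    and less_reach: "s0 < reach K z w"
    and mem_interior_reach: "\<And>s. s0 \<le> s \<Longrightarrow> s < reach K z w \<Longrightarrow> z + s *\<^sub>R w \<in> interior K"
    and reach_notin_interior: "z + reach K z w *\<^sub>R w \<notin> interior K"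
proof -
  let ?S = "{s. z + s *\<^sub>R w \<in> K}"
  obtain M where M: "\<And>x. x \<in> K \<Longrightarrow> norm x \<le> M"
    using compact_imp_bounded[OF K(1)] by (metis bounded_pos)
  have "norm s \<le> (M + norm z) / norm w" if "s \<in> ?S" for s
  proof -
    have "norm (s *\<^sub>R w) \<le> norm (z + s *\<^sub>R w) + norm z"
      by (metis add.commute add_diff_cancel_left' norm_triangle_ineq4)
    then have "\<bar>s\<bar> * norm w \<le> M + norm z" using M[of "z + s *\<^sub>R w"] that by simp
    then show ?thesis using w by (simp add: pos_le_divide_eq)
  qed
  then have "bounded ?S" unfolding bounded_iff by blast
  then have bdd: "bdd_above ?S" by (rule bounded_imp_bdd_above)
  have ne: "?S \<noteq> {}" using s0 interior_subset by auto
  have "continuous_on UNIV (\<lambda>s. z + s *\<^sub>R w)" by (intro continuous_intros)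
  then have "closed ((\<lambda>s. z + s *\<^sub>R w) -` K)"
    using K(1) by (intro closed_vimage compact_imp_closed)
  then have "closed ?S" by (simp add: vimage_def)
  then have "Sup ?S \<in> ?S" by (rule closed_contains_Sup[OF ne bdd])
  then show mem: "z + reach K z w *\<^sub>R w \<in> K" by (simp add: reach_def)
  show le: "s \<le> reach K z w" if "z + s *\<^sub>R w \<in> K" for s
    unfolding reach_def using that bdd by (intro cSup_upper) auto
  have ge: "\<exists>t>s. z + t *\<^sub>R w \<in> K" if "z + s *\<^sub>R w \<in> interior K" for s
  proof -
    obtain e where e: "e > 0" "ball (z + s *\<^sub>R w) e \<subseteq> K"
      using \<open>z + s *\<^sub>R w \<in> interior K\<close> by (meson mem_interior)
    have "z + (s + e / (2 * norm w)) *\<^sub>R w \<in> ball (z + s *\<^sub>R w) e"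
      using w e by (simp add: dist_norm algebra_simps)
    then show ?thesis using e w by (intro exI[of _ "s + e / (2 * norm w)"]) auto
  qed
  show "s0 < reach K z w" using ge[OF s0] le by force
  show "z + reach K z w *\<^sub>R w \<notin> interior K" using ge le by force
  show "z + s *\<^sub>R w \<in> interior K" if "s0 \<le> s" "s < reach K z w" for s
  proof -
    define r where "r = reach K z w"
    define e where "e = (r - s) / (r - s0)"
    have "0 < e" "e \<le> 1" using that by (auto simp: e_def r_def)
    then have "z + r *\<^sub>R w - e *\<^sub>R (z + r *\<^sub>R w - (z + s0 *\<^sub>R w)) \<in> interior K"
      using mem_interior_convex_shrink[OF K(2) s0 mem] by (simp add: r_def)
    moreover have "z + r *\<^sub>R w - e *\<^sub>R (z + r *\<^sub>R w - (z + s0 *\<^sub>R w)) = z + (r - e * (r - s0)) *\<^sub>R w"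
      by (simp add: algebra_simps)
    moreover have "e * (r - s0) = r - s" using that by (simp add: e_def r_def)
    ultimately show ?thesis by (metis diff_diff_eq2 add_diff_cancel_left')
  qed
qed

text \<open>Interior points stay interior on nearby lines, which bounds the reach from below. For
  the upper bound, a point beyond the exit stays outside \<open>K\<close>; a larger reach would, by
  convexity, put it between an interior point and the exit point.\<close>

lemma continuous_on_reach:
  fixes z w :: "real \<Rightarrow> pt"
  assumes K: "compact K" "convex K" and w: "\<And>t. w t \<noteq> 0"
    and int: "\<And>t. \<exists>s. z t + s *\<^sub>R w t \<in> interior K"
    and cont: "continuous_on UNIV z" "continuous_on UNIV w"
  shows "continuous_on UNIV (\<lambda>t. reach K (z t) (w t))"
proof -
  have "((\<lambda>t. reach K (z t) (w t)) \<longlongrightarrow> reach K (z t0) (w t0)) (at t0)" for t0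
  proof -
    obtain s0 where s0: "z t0 + s0 *\<^sub>R w t0 \<in> interior K" using int by blast
    note R0 = reach_props[OF K w s0]
    have lim: "((\<lambda>t. z t + s *\<^sub>R w t) \<longlongrightarrow> z t0 + s *\<^sub>R w t0) (at t0)" for s
      using cont by (intro tendsto_intros) (auto simp: continuous_on_def)
    have ev_int: "\<forall>\<^sub>F t in at t0. z t + s *\<^sub>R w t \<in> interior K" if "z t0 + s *\<^sub>R w t0 \<in> interior K" for s
      by (rule topological_tendstoD[OF lim open_interior that])
    have "open (- K)" using K(1) by (simp add: compact_imp_closed open_Compl)
    then have ev_out: "\<forall>\<^sub>F t in at t0. z t + s *\<^sub>R w t \<in> - K" if "z t0 + s *\<^sub>R w t0 \<notin> K" for s
      by (rule topological_tendstoD[OF lim]) (use that in auto)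
    show ?thesis
    proof (rule order_tendstoI)
      fix c assume c: "c < reach K (z t0) (w t0)"
      define c' where "c' = max s0 ((c + reach K (z t0) (w t0)) / 2)"
      have c': "c' > c" "s0 \<le> c'" "c' < reach K (z t0) (w t0)"
        using c R0(3) by (auto simp: c'_def less_max_iff_disj)
      show "\<forall>\<^sub>F t in at t0. c < reach K (z t) (w t)"
        using ev_int[OF R0(4)[OF c'(2,3)]]
      proof eventually_elim
        case (elim t)
        then show ?case using less_reach[OF K w elim] c' by simp
      qed
    next
      fix c assume c: "c > reach K (z t0) (w t0)"
      then have "z t0 + c *\<^sub>R w t0 \<notin> K" using R0(2)[of c] by auto
      from ev_out[OF this] ev_int[OF s0]
      show "\<forall>\<^sub>F t in at t0. reach K (z t) (w t) < c"
      proof eventually_elim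
        case (elim t)
        note R = reach_props[OF K w elim(2)]
        show ?case
        proof (rule ccontr)
          assume "\<not> ?case"
          then have "z t + c *\<^sub>R w t \<in> K"
            using R(1) R(4)[of c] R0(3) c interior_subset by (cases "c = reach K (z t) (w t)") auto
          then show False using elim by simp
        qed
      qed
    qed
  qed
  then show ?thesis by (simp add: continuous_on_def)
qed

section \<open>Supporting lines and the outer unit normal\<close>

definition supports :: "pt set \<Rightarrow> pt \<Rightarrow> pt \<Rightarrow> bool" where
  "supports K q N \<longleftrightarrow> (\<forall>y\<in>K. N \<bullet> (y - q) \<le> 0)"

lemma supports_interior:
  assumes "supports K q N" "N \<noteq> 0" "y \<in> interior K"
  shows "N \<bullet> (y - q) < 0"
proof -
  obtain e where e: "e > 0" "ball y e \<subseteq> K" using assms(3) by (auto simp: mem_interior)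
  define y' where "y' = y + (e / (2 * norm N)) *\<^sub>R N"
  have "y' \<in> K" using e assms(2) by (intro subsetD[OF e(2)]) (simp add: y'_def dist_norm)
  then have "N \<bullet> (y' - q) \<le> 0" using assms(1) by (auto simp: supports_def)
  moreover have "N \<bullet> (y' - q) = N \<bullet> (y - q) + e / (2 * norm N) * (N \<bullet> N)"
    by (simp add: y'_def inner_diff_right inner_add_right)
  moreover have "e / (2 * norm N) * (N \<bullet> N) > 0" using e assms(2) by simp
  ultimately show ?thesis by linarith
qed

definition smooth_body :: "pt set \<Rightarrow> bool" where
  "smooth_body K \<longleftrightarrow> convex_body K \<and>
     (\<forall>q\<in>frontier K. \<forall>N N'. norm N = 1 \<and> supports K q N \<and> norm N' = 1 \<and> supports K q N' \<longrightarrow> N = N')"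

text \<open>At a boundary point \<open>\<gamma> s\<close>, a supporting functional has a maximum
  along the curve, so its normal is orthogonal to the nonzero velocity. In the plane this fixes a
  unit normal up to sign, and an interior point decides the sign.\<close>

lemma C2_boundary_imp_smooth_body:
  assumes K: "convex_body K" and "C2_boundary K"
  shows "smooth_body K"
proof -
  obtain \<gamma> \<gamma>1 :: "real \<Rightarrow> pt" and L where L: "L > 0" and per: "\<And>s. \<gamma> (s + L) = \<gamma> s"
    and der: "\<And>s. (\<gamma> has_vector_derivative \<gamma>1 s) (at s)" and nz: "\<And>s. \<gamma>1 s \<noteq> 0"
    and im: "\<gamma> ` {0..L} = frontier K"
    using assms(2) unfolding C2_boundary_def by blast
  have fK: "frontier K \<subseteq> K"
    using K by (simp add: convex_body_def compact_imp_closed frontier_subset_closed)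
  \<comment> \<open>At the ends of \<open>{0..L}\<close> the maximum is two-sided only because the
    curve continues periodically.\<close>
  have inK: "\<gamma> t \<in> K" if "\<bar>s - t\<bar> < L" "s \<in> {0..L}" for s t
  proof -
    consider "t \<in> {0..L}" | "t + L \<in> {0..L}" | "t - L \<in> {0..L}"
      using \<open>\<bar>s - t\<bar> < L\<close> \<open>s \<in> {0..L}\<close> unfolding atLeastAtMost_iff by linarith
    then show ?thesis
    proof cases
      case 2 then show ?thesis using per[of t] im fK by (metis imageI subsetD)
    next
      case 3 then show ?thesis using per[of "t - L"] im fK by (metis imageI subsetD diff_add_cancel)
    qed (use im fK in auto)
  qed
  have orth: "N \<bullet> \<gamma>1 s = 0" if s: "s \<in> {0..L}" and N: "supports K (\<gamma> s) N" for s N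
  proof (rule DERIV_local_max[OF _ L])
    show "DERIV (\<lambda>t. N \<bullet> \<gamma> t) s :> N \<bullet> \<gamma>1 s"
      using has_derivative_inner_right[OF der[of s, unfolded has_vector_derivative_def], of N]
      by (simp add: has_field_derivative_def mult_commute_abs)
    show "\<forall>t. \<bar>s - t\<bar> < L \<longrightarrow> N \<bullet> \<gamma> t \<le> N \<bullet> \<gamma> s"
      using inK[OF _ s] N by (auto simp: supports_def inner_diff_right)
  qed
  have "N = N'" if q: "q \<in> frontier K" and N: "norm N = 1" "supports K q N"
    and N': "norm N' = 1" "supports K q N'" for q N N'
  proof -
    obtain s where s: "s \<in> {0..L}" "q = \<gamma> s" using q im by blast
    define g where "g = \<gamma>1 s"
    have o: "N \<bullet> g = 0" "N' \<bullet> g = 0" using orth s N N' by (auto simp: g_def)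
    let ?d = "N $ 1 * N' $ 2 - N $ 2 * N' $ 1"
    have "?d * g $ 1 = N' $ 2 * (N \<bullet> g) - N $ 2 * (N' \<bullet> g)"
         "?d * g $ 2 = N $ 1 * (N' \<bullet> g) - N' $ 1 * (N \<bullet> g)"
      unfolding inner_pt by algebra+
    then have "?d * g $ 1 = 0" "?d * g $ 2 = 0" using o by auto
    moreover have "g $ 1 \<noteq> 0 \<or> g $ 2 \<noteq> 0" using nz[of s] by (auto simp: g_def pt_eq_iff)
    ultimately have d: "?d = 0" by auto
    have n1: "N \<bullet> N = 1" "N' \<bullet> N' = 1" using N N' by (auto simp: norm_eq_1)
    have "(N \<bullet> N')\<^sup>2 = (N \<bullet> N) * (N' \<bullet> N') - ?d\<^sup>2" unfolding inner_pt by algebra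
    then have "(N \<bullet> N')\<^sup>2 = 1" using d n1 by simp
    then have "N \<bullet> N' = 1 \<or> N \<bullet> N' = - 1" by (simp add: power2_eq_1_iff)
    then show ?thesis
    proof
      assume "N \<bullet> N' = 1"
      then have "(N - N') \<bullet> (N - N') = 0"
        using n1 by (simp add: inner_diff_left inner_diff_right inner_commute)
      then show ?thesis by simp
    next
      assume "N \<bullet> N' = - 1"
      then have "(N + N') \<bullet> (N + N') = 0"
        using n1 by (simp add: inner_add_left inner_add_right inner_commute)
      then have "N' = - N" by (simp add: eq_neg_iff_add_eq_0 add.commute)
      moreover obtain y where "y \<in> interior K" using K by (auto simp: convex_body_def)
      moreover have "N \<noteq> 0" "N' \<noteq> 0" using N N' by auto
      ultimately have "N \<bullet> (y - q) < 0" "- N \<bullet> (y - q) < 0"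
        using supports_interior[of K q N y] supports_interior[of K q N' y] N N' by auto
      then show ?thesis by simp
    qed
  qed
  then show ?thesis using K unfolding smooth_body_def by blast
qed

definition normal :: "pt set \<Rightarrow> pt \<Rightarrow> pt" where
  "normal K q = (SOME N. norm N = 1 \<and> supports K q N)"

lemma normal_props:
  assumes "convex_body K" "q \<in> frontier K"
  shows norm_normal: "norm (normal K q) = 1" and supports_normal: "supports K q (normal K q)"
proof -
  have K: "compact K" "convex K" "interior K \<noteq> {}" using assms by (auto simp: convex_body_def)
  have "q \<in> K" "q \<notin> interior K"
    using assms(2) K by (auto simp: frontier_def compact_imp_closed closure_closed)
  then have "q \<notin> rel_interior K" using K by (simp add: rel_interior_nonempty_interior)
  then obtain a where a: "a \<noteq> 0" "\<And>y. y \<in> K \<Longrightarrow> a \<bullet> q \<le> a \<bullet> y"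
    using supporting_hyperplane_rel_boundary[OF K(2) \<open>q \<in> K\<close>] by metis
  have "norm (- sgn a) = 1 \<and> supports K q (- sgn a)"
    using a by (auto simp: norm_sgn supports_def sgn_div_norm inner_diff_right divide_right_mono
        intro!: mult_left_mono)
  then have "norm (normal K q) = 1 \<and> supports K q (normal K q)"
    unfolding normal_def by (rule someI)
  then show "norm (normal K q) = 1" "supports K q (normal K q)" by auto
qed

text \<open>By uniqueness of the normal, the graph consists of all pairs of a boundary point and a
  supporting unit vector. These conditions are closed, and a map into a compact space with closed
  graph is continuous.\<close>

lemma continuous_on_normal:
  assumes "smooth_body K"
  shows "continuous_on (frontier K) (normal K)"
proof (rule continuous_from_closed_graph)
  show "compact (sphere (0::pt) 1)" by simp
  have K: "convex_body K" using assms by (simp add: smooth_body_def)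
  show "normal K \<in> frontier K \<rightarrow> sphere 0 1" using norm_normal[OF K] by auto
  have "(\<lambda>q. (q, normal K q)) ` frontier K =
     (frontier K \<times> sphere 0 1) \<inter> (\<Inter>y\<in>K. {p. snd p \<bullet> (y - fst p) \<le> 0})" (is "?L = ?R")
  proof
    show "?L \<subseteq> ?R" using normal_props[OF K] by (auto simp: supports_def)
    show "?R \<subseteq> ?L"
    proof
      fix p assume "p \<in> ?R"
      then have p: "fst p \<in> frontier K" "norm (snd p) = 1" "supports K (fst p) (snd p)"
        by (auto simp: supports_def)
      then have "snd p = normal K (fst p)"
        using normal_props[OF K p(1)] assms unfolding smooth_body_def by blast
      then show "p \<in> ?L" using p(1) by (intro image_eqI[of _ _ "fst p"]) (auto simp: prod_eq_iff)
    qed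
  qed
  moreover have "closed (\<Inter>y\<in>K. {p::pt \<times> pt. snd p \<bullet> (y - fst p) \<le> 0})"
    by (intro closed_INT ballI closed_Collect_le continuous_intros)
  ultimately show "closed ((\<lambda>q. (q, normal K q)) ` frontier K)"
    by (simp add: closed_Int closed_Times)
qed

section \<open>Dupin's theorem\<close>

definition tng :: "real \<Rightarrow> pt" where
  "tng \<theta> = vector [- sin \<theta>, cos \<theta>]"

lemma frame_dir: "frame (dir \<theta>) (tng \<theta>)"
proof -
  have "sin \<theta> * sin \<theta> + cos \<theta> * cos \<theta> = 1"
    using sin_cos_squared_add[of \<theta>] by (simp add: power2_eq_square)
  then show ?thesis by (simp add: frame_def dir_def tng_def inner_pt add.commute)
qed

lemma frame_dir_simps [simp]:
  "dir \<theta> \<bullet> dir \<theta> = 1" "tng \<theta> \<bullet> tng \<theta> = 1" "dir \<theta> \<bullet> tng \<theta> = 0" "tng \<theta> \<bullet> dir \<theta> = 0"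
  "norm (dir \<theta>) = 1" "norm (tng \<theta>) = 1"
  using frame_dir[of \<theta>] frame_norm[OF frame_dir[of \<theta>]] by (auto simp: frame_def inner_commute)

lemma tng_nonzero [simp]: "tng \<theta> \<noteq> 0" "dir \<theta> \<noteq> 0"
  using frame_dir_simps(5,6)[of \<theta>] by force+

lemma dir_add: "dir (\<theta> + \<epsilon>) = cos \<epsilon> *\<^sub>R dir \<theta> + sin \<epsilon> *\<^sub>R tng \<theta>"
  by (simp add: dir_def tng_def pt_eq_iff cos_add sin_add algebra_simps)

lemma dir_pi: "dir (\<theta> + pi) = - dir \<theta>" "tng (\<theta> + pi) = - tng \<theta>"
  by (simp_all add: dir_def tng_def pt_eq_iff)

lemma dir_periodic: "dir (\<theta> + 2 * pi) = dir \<theta>" "tng (\<theta> + 2 * pi) = tng \<theta>"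
  by (simp_all add: dir_def tng_def)

lemma dir_inner_dir: "dir \<theta> \<bullet> dir \<phi> = cos (\<phi> - \<theta>)" "dir \<theta> \<bullet> tng \<phi> = - sin (\<phi> - \<theta>)"
  "tng \<theta> \<bullet> dir \<phi> = sin (\<phi> - \<theta>)" "tng \<theta> \<bullet> tng \<phi> = cos (\<phi> - \<theta>)"
  by (simp_all add: dir_def tng_def inner_pt cos_diff sin_diff)

lemma dir_surj:
  assumes "norm \<xi> = 1"
  shows "\<exists>\<theta>. \<xi> = dir \<theta>"
proof -
  have "(\<xi> $ 1)\<^sup>2 + (\<xi> $ 2)\<^sup>2 = 1"
    using assms by (simp add: norm_eq_1 inner_pt power2_eq_square)
  then obtain \<theta> where "\<xi> $ 1 = cos \<theta>" "\<xi> $ 2 = sin \<theta>"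
    using sincos_total_2pi by metis
  then show ?thesis by (intro exI[of _ \<theta>]) (simp add: dir_def pt_eq_iff)
qed

lemma dir_eq: "dir = (\<lambda>\<theta>. cos \<theta> *\<^sub>R vector [1, 0] + sin \<theta> *\<^sub>R vector [0, 1])"
  by (simp add: fun_eq_iff dir_def pt_eq_iff)

lemma tng_eq: "tng = (\<lambda>\<theta>. (- sin \<theta>) *\<^sub>R vector [1, 0] + cos \<theta> *\<^sub>R vector [0, 1])"
  by (simp add: fun_eq_iff tng_def pt_eq_iff)

lemma continuous_on_dir: "continuous_on S dir" "continuous_on S tng"
  unfolding dir_eq tng_eq by (intro continuous_intros)+

lemma vector_derivative_dir: "vector_derivative dir (at \<theta>) = tng \<theta>"
proof (rule vector_derivative_at)
  show "(dir has_vector_derivative tng \<theta>) (at \<theta>)"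
    unfolding dir_eq tng_eq has_vector_derivative_def
    by (auto intro!: derivative_eq_intros simp: algebra_simps)
qed

lemma DERIV_dir_inner:
  "((\<lambda>\<theta>. dir \<theta> \<bullet> x) has_real_derivative tng \<theta> \<bullet> x) (at \<theta>)"
  "((\<lambda>\<theta>. tng \<theta> \<bullet> x) has_real_derivative - (dir \<theta> \<bullet> x)) (at \<theta>)"
  unfolding dir_def tng_def inner_pt by (auto intro!: derivative_eq_intros)

text \<open>These assumptions are invariant under replacing \<open>\<delta>\<close> by
  \<open>area K - \<delta>\<close>, so the locale can be interpreted for either side of the
  lines.\<close>

locale flotation =
  fixes K :: "pt set" and \<delta> :: real
  assumes smooth: "smooth_body K" and \<delta>: "0 < \<delta>" "\<delta> < area K"
begin

lemma K: "convex_body K" "compact K" "convex K" "closed K" "interior K \<noteq> {}"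
  using smooth by (auto simp: smooth_body_def convex_body_def compact_imp_closed)

definition h :: "real \<Rightarrow> real" where "h \<theta> = flot_level K \<delta> (dir \<theta>)"

text \<open>The chord lies on the line \<open>pnt \<theta>\<close>, over the parameters \<open>bm \<theta>\<close> to \<open>bp \<theta>\<close>.\<close>
definition pnt :: "real \<Rightarrow> real \<Rightarrow> pt" where "pnt \<theta> s = h \<theta> *\<^sub>R dir \<theta> + s *\<^sub>R tng \<theta>"

definition bp :: "real \<Rightarrow> real" where "bp \<theta> = reach K (h \<theta> *\<^sub>R dir \<theta>) (tng \<theta>)"

definition bm :: "real \<Rightarrow> real" where "bm \<theta> = - reach K (h \<theta> *\<^sub>R dir \<theta>) (- tng \<theta>)"

definition mid :: "real \<Rightarrow> real" where "mid \<theta> = (bp \<theta> + bm \<theta>) / 2"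

definition hw :: "real \<Rightarrow> real" where "hw \<theta> = (bp \<theta> - bm \<theta>) / 2"

lemma dir_pnt: "dir \<theta> \<bullet> pnt \<theta> s = h \<theta>" "tng \<theta> \<bullet> pnt \<theta> s = s"
  by (simp_all add: pnt_def inner_add_right)

lemma chord_interior: obtains s where "pnt \<theta> s \<in> interior K"
proof -
  obtain x where x: "x \<in> interior K" "dir \<theta> \<bullet> x = h \<theta>"
    using flot_line_meets_interior[OF K(1) \<delta>, of "dir \<theta>"] by (auto simp: h_def)
  then have "x = pnt \<theta> (tng \<theta> \<bullet> x)"
    using frame_expand[OF frame_dir, of x \<theta>] by (simp add: pnt_def)
  then show thesis using x that by metis
qed

lemma chord_props:
  shows chord_mem: "pnt \<theta> (bp \<theta>) \<in> K" "pnt \<theta> (bm \<theta>) \<in> K"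
    and chord_bounds: "pnt \<theta> s \<in> K \<Longrightarrow> bm \<theta> \<le> s \<and> s \<le> bp \<theta>"
    and chord_interior_mem: "bm \<theta> < s \<Longrightarrow> s < bp \<theta> \<Longrightarrow> pnt \<theta> s \<in> interior K"
    and bm_less_bp: "bm \<theta> < bp \<theta>"
    and chord_frontier: "pnt \<theta> (bp \<theta>) \<in> frontier K" "pnt \<theta> (bm \<theta>) \<in> frontier K"
proof -
  obtain s0 where s0: "pnt \<theta> s0 \<in> interior K" by (rule chord_interior)
  then have s1: "h \<theta> *\<^sub>R dir \<theta> + s0 *\<^sub>R tng \<theta> \<in> interior K"
    and s2: "h \<theta> *\<^sub>R dir \<theta> + (- s0) *\<^sub>R (- tng \<theta>) \<in> interior K" by (auto simp: pnt_def)
  note P = reach_props[OF K(2,3) tng_nonzero(1) s1, folded bp_def]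
  have nz: "- tng \<theta> \<noteq> 0" by simp
  note M = reach_props[OF K(2,3) nz s2]
  have M': "reach K (h \<theta> *\<^sub>R dir \<theta>) (- tng \<theta>) = - bm \<theta>" by (simp add: bm_def)
  show mem: "pnt \<theta> (bp \<theta>) \<in> K" "pnt \<theta> (bm \<theta>) \<in> K"
    using P(1) M(1) unfolding M' by (auto simp: pnt_def)
  show "bm \<theta> \<le> s \<and> s \<le> bp \<theta>" if "pnt \<theta> s \<in> K" for s
    using P(2)[of s] M(2)[of "- s"] that unfolding M' by (auto simp: pnt_def)
  show "bm \<theta> < bp \<theta>" using P(3) M(3) unfolding M' by simp
  show "pnt \<theta> s \<in> interior K" if "bm \<theta> < s" "s < bp \<theta>" for s
    using P(4)[of s] M(4)[of "- s"] that unfolding M' by (cases "s0 \<le> s") (auto simp: pnt_def)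
  have "pnt \<theta> (bp \<theta>) \<notin> interior K" "pnt \<theta> (bm \<theta>) \<notin> interior K"
    using P(5) M(5) unfolding M' by (auto simp: pnt_def)
  then show "pnt \<theta> (bp \<theta>) \<in> frontier K" "pnt \<theta> (bm \<theta>) \<in> frontier K"
    using mem K(4) by (auto simp: frontier_def)
qed

lemma hw_pos: "hw \<theta> > 0"
  using bm_less_bp[of \<theta>] by (simp add: hw_def)

text \<open>Turning the line about a point \<open>c\<close> of the chord that is not its midpoint changes the area
  cut off to first order; comparing with the line of the right area localises \<open>h (\<theta> + \<epsilon>)\<close>.\<close>
lemma h_rotate_upper:
  assumes c: "mid \<theta> < c" "c < bp \<theta>"
  obtains e where "e > 0"
    "\<And>\<epsilon>. 0 < \<epsilon> \<Longrightarrow> \<epsilon> < e \<Longrightarrow> h (\<theta> + \<epsilon>) < cos \<epsilon> * h \<theta> + sin \<epsilon> * c"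
    "\<And>\<epsilon>. 0 < \<epsilon> \<Longrightarrow> \<epsilon> < e \<Longrightarrow> cos \<epsilon> * h \<theta> - sin \<epsilon> * c < h (\<theta> - \<epsilon>)"
proof -
  define z where "z = pnt \<theta> c"
  \<comment> \<open>The margin makes \<open>r\<close> slightly longer than the arm of the chord
    towards \<open>bp\<close>, so that its end is outside \<open>K\<close>, and \<open>R\<close>
    slightly shorter than the other arm, so that its end is interior. Still
    \<open>R - r = c - mid \<theta>\<close> is positive.\<close>
  define \<eta> where "\<eta> = (c - mid \<theta>) / 2"
  define r where "r = bp \<theta> - c + \<eta>"
  define R where "R = c - bm \<theta> - \<eta>"
  have \<eta>: "\<eta> > 0" "0 < r" "r < R" using c by (auto simp: \<eta>_def r_def R_def mid_def field_simps)
  have inside: "z - R *\<^sub>R tng \<theta> \<in> interior K"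
  proof -
    have "pnt \<theta> (c - R) \<in> interior K"
      by (rule chord_interior_mem) (use \<eta> c in \<open>auto simp: R_def r_def\<close>)
    then show ?thesis by (simp add: z_def pnt_def algebra_simps)
  qed
  have outside: "z + r *\<^sub>R tng \<theta> \<notin> K"
  proof
    assume "z + r *\<^sub>R tng \<theta> \<in> K"
    then have "pnt \<theta> (c + r) \<in> K" by (simp add: z_def pnt_def algebra_simps)
    then show False using chord_bounds[of \<theta> "c + r"] \<eta> by (simp add: r_def)
  qed
  have zK: "z \<in> K"
    using chord_interior_mem[of \<theta> c] c bm_less_bp[of \<theta>] interior_subset
    by (auto simp: z_def mid_def field_simps)
  have area: "area (K \<inter> cap (dir \<theta>) (dir \<theta> \<bullet> z)) = \<delta>"
    using area_flot_level[OF K(1) \<delta>, of "dir \<theta>"] by (simp add: z_def dir_pnt h_def)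
  obtain e1 where e1: "e1 > 0" "\<And>\<epsilon>. 0 < \<epsilon> \<Longrightarrow> \<epsilon> < e1 \<Longrightarrow>
      area (K \<inter> cap (cos \<epsilon> *\<^sub>R dir \<theta> + sin \<epsilon> *\<^sub>R tng \<theta>) ((cos \<epsilon> *\<^sub>R dir \<theta> + sin \<epsilon> *\<^sub>R tng \<theta>) \<bullet> z))
      < area (K \<inter> cap (dir \<theta>) (dir \<theta> \<bullet> z))"
    using rotation_decreases_area[OF frame_dir K(2,3) zK \<eta>(2,3) inside outside] by blast
  \<comment> \<open>Turning backwards is the same estimate for the complementary cap, whose loss is
    a gain for the original one.\<close>
  obtain e2 where e2: "e2 > 0" "\<And>\<epsilon>. 0 < \<epsilon> \<Longrightarrow> \<epsilon> < e2 \<Longrightarrow>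
      area (K \<inter> cap (cos \<epsilon> *\<^sub>R (- dir \<theta>) + sin \<epsilon> *\<^sub>R tng \<theta>) ((cos \<epsilon> *\<^sub>R (- dir \<theta>) + sin \<epsilon> *\<^sub>R tng \<theta>) \<bullet> z))
      < area (K \<inter> cap (- dir \<theta>) (- dir \<theta> \<bullet> z))"
    using rotation_decreases_area[OF frame_uminus(1)[OF frame_dir] K(2,3) zK \<eta>(2,3) inside outside]
    by blast
  show thesis
  proof (rule that[of "min e1 e2"])
    fix \<epsilon> :: real assume \<epsilon>: "0 < \<epsilon>" "\<epsilon> < min e1 e2"
    have "area (K \<inter> cap (dir (\<theta> + \<epsilon>)) (dir (\<theta> + \<epsilon>) \<bullet> z)) < \<delta>"
      using e1(2)[of \<epsilon>] \<epsilon> unfolding dir_add area by simp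
    then have "h (\<theta> + \<epsilon>) < dir (\<theta> + \<epsilon>) \<bullet> z"
      unfolding h_def by (intro flot_level_lessI K \<delta>) auto
    then show "h (\<theta> + \<epsilon>) < cos \<epsilon> * h \<theta> + sin \<epsilon> * c"
      by (simp add: dir_add inner_add_left z_def dir_pnt)
    have d: "cos \<epsilon> *\<^sub>R (- dir \<theta>) + sin \<epsilon> *\<^sub>R tng \<theta> = - dir (\<theta> - \<epsilon>)"
      using dir_add[of \<theta> "- \<epsilon>"] by simp
    have "area (K \<inter> cap (- dir (\<theta> - \<epsilon>)) (- (dir (\<theta> - \<epsilon>) \<bullet> z))) < area (K \<inter> cap (- dir \<theta>) (- (dir \<theta> \<bullet> z)))"
      using e2(2)[of \<epsilon>] \<epsilon> unfolding d by simp
    then have "\<delta> < area (K \<inter> cap (dir (\<theta> - \<epsilon>)) (dir (\<theta> - \<epsilon>) \<bullet> z))"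
      using area by (simp add: area_complement_cap K)
    then have "dir (\<theta> - \<epsilon>) \<bullet> z < h (\<theta> - \<epsilon>)"
      unfolding h_def by (intro flot_level_gtI K \<delta>) auto
    then show "cos \<epsilon> * h \<theta> - sin \<epsilon> * c < h (\<theta> - \<epsilon>)"
      using dir_add[of \<theta> "- \<epsilon>"] by (simp add: inner_diff_left z_def dir_pnt)
  qed (use e1 e2 in auto)
qed

text \<open>The mirror image: now the arm towards \<open>bp\<close> is the longer one, so the
  estimate is applied with the tangent vector reversed.\<close>

lemma h_rotate_lower:
  assumes c: "bm \<theta> < c" "c < mid \<theta>"
  obtains e where "e > 0"
    "\<And>\<epsilon>. 0 < \<epsilon> \<Longrightarrow> \<epsilon> < e \<Longrightarrow> cos \<epsilon> * h \<theta> + sin \<epsilon> * c < h (\<theta> + \<epsilon>)"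
    "\<And>\<epsilon>. 0 < \<epsilon> \<Longrightarrow> \<epsilon> < e \<Longrightarrow> h (\<theta> - \<epsilon>) < cos \<epsilon> * h \<theta> - sin \<epsilon> * c"
proof -
  define z where "z = pnt \<theta> c"
  define \<eta> where "\<eta> = (mid \<theta> - c) / 2"
  define r where "r = c - bm \<theta> + \<eta>"
  define R where "R = bp \<theta> - c - \<eta>"
  have \<eta>: "\<eta> > 0" "0 < r" "r < R" using c by (auto simp: \<eta>_def r_def R_def mid_def field_simps)
  have inside: "z - R *\<^sub>R (- tng \<theta>) \<in> interior K"
  proof -
    have "pnt \<theta> (c + R) \<in> interior K"
      by (rule chord_interior_mem) (use \<eta> c in \<open>auto simp: R_def r_def\<close>)
    then show ?thesis by (simp add: z_def pnt_def algebra_simps)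
  qed
  have outside: "z + r *\<^sub>R (- tng \<theta>) \<notin> K"
  proof
    assume "z + r *\<^sub>R (- tng \<theta>) \<in> K"
    then have "pnt \<theta> (c - r) \<in> K" by (simp add: z_def pnt_def algebra_simps)
    then show False using chord_bounds[of \<theta> "c - r"] \<eta> by (simp add: r_def)
  qed
  have zK: "z \<in> K"
    using chord_interior_mem[of \<theta> c] c bm_less_bp[of \<theta>] interior_subset
    by (auto simp: z_def mid_def field_simps)
  have area: "area (K \<inter> cap (dir \<theta>) (dir \<theta> \<bullet> z)) = \<delta>"
    using area_flot_level[OF K(1) \<delta>, of "dir \<theta>"] by (simp add: z_def dir_pnt h_def)
  obtain e1 where e1: "e1 > 0" "\<And>\<epsilon>. 0 < \<epsilon> \<Longrightarrow> \<epsilon> < e1 \<Longrightarrow>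
      area (K \<inter> cap (cos \<epsilon> *\<^sub>R dir \<theta> + sin \<epsilon> *\<^sub>R (- tng \<theta>)) ((cos \<epsilon> *\<^sub>R dir \<theta> + sin \<epsilon> *\<^sub>R (- tng \<theta>)) \<bullet> z))
      < area (K \<inter> cap (dir \<theta>) (dir \<theta> \<bullet> z))"
    using rotation_decreases_area[OF frame_uminus(2)[OF frame_dir] K(2,3) zK \<eta>(2,3) inside outside]
    by blast
  obtain e2 where e2: "e2 > 0" "\<And>\<epsilon>. 0 < \<epsilon> \<Longrightarrow> \<epsilon> < e2 \<Longrightarrow>
      area (K \<inter> cap (cos \<epsilon> *\<^sub>R (- dir \<theta>) + sin \<epsilon> *\<^sub>R (- tng \<theta>)) ((cos \<epsilon> *\<^sub>R (- dir \<theta>) + sin \<epsilon> *\<^sub>R (- tng \<theta>)) \<bullet> z))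
      < area (K \<inter> cap (- dir \<theta>) (- dir \<theta> \<bullet> z))"
    using rotation_decreases_area[OF frame_uminus(1)[OF frame_uminus(2)[OF frame_dir]] K(2,3) zK \<eta>(2,3) inside outside]
    by blast
  show thesis
  proof (rule that[of "min e1 e2"])
    fix \<epsilon> :: real assume \<epsilon>: "0 < \<epsilon>" "\<epsilon> < min e1 e2"
    have d: "cos \<epsilon> *\<^sub>R dir \<theta> + sin \<epsilon> *\<^sub>R (- tng \<theta>) = dir (\<theta> - \<epsilon>)"
      using dir_add[of \<theta> "- \<epsilon>"] by simp
    have "area (K \<inter> cap (dir (\<theta> - \<epsilon>)) (dir (\<theta> - \<epsilon>) \<bullet> z)) < \<delta>"
      using e1(2)[of \<epsilon>] \<epsilon> unfolding d area by simp
    then have "h (\<theta> - \<epsilon>) < dir (\<theta> - \<epsilon>) \<bullet> z"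
      unfolding h_def by (intro flot_level_lessI K \<delta>) auto
    then show "h (\<theta> - \<epsilon>) < cos \<epsilon> * h \<theta> - sin \<epsilon> * c"
      by (simp add: d[symmetric] inner_diff_left z_def dir_pnt)
    have d': "cos \<epsilon> *\<^sub>R (- dir \<theta>) + sin \<epsilon> *\<^sub>R (- tng \<theta>) = - dir (\<theta> + \<epsilon>)"
      by (simp add: dir_add)
    have "area (K \<inter> cap (- dir (\<theta> + \<epsilon>)) (- (dir (\<theta> + \<epsilon>) \<bullet> z))) < area (K \<inter> cap (- dir \<theta>) (- (dir \<theta> \<bullet> z)))"
      using e2(2)[of \<epsilon>] \<epsilon> unfolding d' by simp
    then have "\<delta> < area (K \<inter> cap (dir (\<theta> + \<epsilon>)) (dir (\<theta> + \<epsilon>) \<bullet> z))"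
      using area by (simp add: area_complement_cap K)
    then have "dir (\<theta> + \<epsilon>) \<bullet> z < h (\<theta> + \<epsilon>)"
      unfolding h_def by (intro flot_level_gtI K \<delta>) auto
    then show "cos \<epsilon> * h \<theta> + sin \<epsilon> * c < h (\<theta> + \<epsilon>)"
      by (simp add: dir_add inner_add_left z_def dir_pnt)
  qed (use e1 e2 in auto)
qed

text \<open>Pivots on either side of the midpoint give opposite bounds for the quotient
  \<open>q\<close>, valid for both signs of the angle. Moving the pivots to the midpoint squeezes
  the limit.\<close>

lemma DERIV_h: "(h has_real_derivative mid \<theta>) (at \<theta>)"
proof -
  define q where "q \<epsilon> = (h (\<theta> + \<epsilon>) - cos \<epsilon> * h \<theta>) / sin \<epsilon>" for \<epsilon>
  have b: "bm \<theta> < mid \<theta>" "mid \<theta> < bp \<theta>" using bm_less_bp[of \<theta>] by (auto simp: mid_def)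
  have sin_pos: "sin \<epsilon> > 0" if "0 < \<epsilon>" "\<epsilon> < 1" for \<epsilon> :: real
    using that pi_gt3 by (intro sin_gt_zero) auto
  have q: "(q \<longlongrightarrow> mid \<theta>) (at 0)"
  proof (rule order_tendstoI)
    fix l assume "l < mid \<theta>"
    \<comment> \<open>The bound \<open>l\<close> itself may lie beyond the end of the chord; then a
      pivot inside the chord gives a stronger bound.\<close>
    define c where "c = max ((bm \<theta> + mid \<theta>) / 2) l"
    have c: "bm \<theta> < c" "c < mid \<theta>" "l \<le> c" using \<open>l < mid \<theta>\<close> b by (auto simp: c_def less_max_iff_disj)
    obtain e where e: "e > 0"
      "\<And>\<epsilon>. 0 < \<epsilon> \<Longrightarrow> \<epsilon> < e \<Longrightarrow> cos \<epsilon> * h \<theta> + sin \<epsilon> * c < h (\<theta> + \<epsilon>)"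
      "\<And>\<epsilon>. 0 < \<epsilon> \<Longrightarrow> \<epsilon> < e \<Longrightarrow> h (\<theta> - \<epsilon>) < cos \<epsilon> * h \<theta> - sin \<epsilon> * c"
      using h_rotate_lower[OF c(1,2)] by blast
    show "\<forall>\<^sub>F \<epsilon> in at 0. l < q \<epsilon>"
      unfolding eventually_at
    proof (intro exI[of _ "min e 1"] conjI ballI impI)
      fix \<epsilon> :: real assume \<epsilon>: "\<epsilon> \<noteq> 0 \<and> dist \<epsilon> 0 < min e 1"
      show "l < q \<epsilon>"
      proof (cases "\<epsilon> > 0")
        case True
        then have s: "sin \<epsilon> > 0" using sin_pos[of \<epsilon>] \<epsilon> by (simp add: dist_real_def)
        then have "l * sin \<epsilon> \<le> c * sin \<epsilon>" using c(3) by simp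
        moreover have "cos \<epsilon> * h \<theta> + sin \<epsilon> * c < h (\<theta> + \<epsilon>)"
          using e(2)[of \<epsilon>] True \<epsilon> by (simp add: dist_real_def)
        ultimately have "l * sin \<epsilon> < h (\<theta> + \<epsilon>) - cos \<epsilon> * h \<theta>" by (simp add: mult.commute)
        then show ?thesis using s by (simp add: q_def pos_less_divide_eq)
      next
        case False
        then have s: "sin \<epsilon> < 0" using sin_pos[of "- \<epsilon>"] \<epsilon> by (simp add: dist_real_def)
        then have "c * sin \<epsilon> \<le> l * sin \<epsilon>" using c(3) by simp
        moreover have "h (\<theta> + \<epsilon>) < cos \<epsilon> * h \<theta> + sin \<epsilon> * c"
          using e(3)[of "- \<epsilon>"] False \<epsilon> by (simp add: dist_real_def)
        ultimately have "h (\<theta> + \<epsilon>) - cos \<epsilon> * h \<theta> < l * sin \<epsilon>" by (simp add: mult.commute)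
        then show ?thesis using s by (simp add: q_def neg_less_divide_eq)
      qed
    qed (use e in auto)
  next
    fix l assume "l > mid \<theta>"
    define c where "c = min ((bp \<theta> + mid \<theta>) / 2) l"
    have c: "mid \<theta> < c" "c < bp \<theta>" "c \<le> l" using \<open>l > mid \<theta>\<close> b by (auto simp: c_def min_less_iff_disj)
    obtain e where e: "e > 0"
      "\<And>\<epsilon>. 0 < \<epsilon> \<Longrightarrow> \<epsilon> < e \<Longrightarrow> h (\<theta> + \<epsilon>) < cos \<epsilon> * h \<theta> + sin \<epsilon> * c"
      "\<And>\<epsilon>. 0 < \<epsilon> \<Longrightarrow> \<epsilon> < e \<Longrightarrow> cos \<epsilon> * h \<theta> - sin \<epsilon> * c < h (\<theta> - \<epsilon>)"
      using h_rotate_upper[OF c(1,2)] by blast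
    show "\<forall>\<^sub>F \<epsilon> in at 0. q \<epsilon> < l"
      unfolding eventually_at
    proof (intro exI[of _ "min e 1"] conjI ballI impI)
      fix \<epsilon> :: real assume \<epsilon>: "\<epsilon> \<noteq> 0 \<and> dist \<epsilon> 0 < min e 1"
      show "q \<epsilon> < l"
      proof (cases "\<epsilon> > 0")
        case True
        then have s: "sin \<epsilon> > 0" using sin_pos[of \<epsilon>] \<epsilon> by (simp add: dist_real_def)
        then have "c * sin \<epsilon> \<le> l * sin \<epsilon>" using c(3) by simp
        moreover have "h (\<theta> + \<epsilon>) < cos \<epsilon> * h \<theta> + sin \<epsilon> * c"
          using e(2)[of \<epsilon>] True \<epsilon> by (simp add: dist_real_def)
        ultimately have "h (\<theta> + \<epsilon>) - cos \<epsilon> * h \<theta> < l * sin \<epsilon>" by (simp add: mult.commute)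
        then show ?thesis using s by (simp add: q_def pos_divide_less_eq)
      next
        case False
        then have s: "sin \<epsilon> < 0" using sin_pos[of "- \<epsilon>"] \<epsilon> by (simp add: dist_real_def)
        then have "l * sin \<epsilon> \<le> c * sin \<epsilon>" using c(3) by simp
        moreover have "cos \<epsilon> * h \<theta> + sin \<epsilon> * c < h (\<theta> + \<epsilon>)"
          using e(3)[of "- \<epsilon>"] False \<epsilon> by (simp add: dist_real_def)
        ultimately have "l * sin \<epsilon> < h (\<theta> + \<epsilon>) - cos \<epsilon> * h \<theta>" by (simp add: mult.commute)
        then show ?thesis using s by (simp add: q_def neg_divide_less_eq)
      qed
    qed (use e in auto)
  qed
  have "(sin has_real_derivative 1) (at 0)" "(cos has_real_derivative 0) (at 0)"
    using DERIV_sin[of "0::real"] DERIV_cos[of "0::real"] by auto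
  then have l: "((\<lambda>\<epsilon>. sin \<epsilon> / \<epsilon>) \<longlongrightarrow> (1::real)) (at 0)" "((\<lambda>\<epsilon>. (cos \<epsilon> - 1) / \<epsilon>) \<longlongrightarrow> (0::real)) (at 0)"
    by (auto simp: has_field_derivative_iff)
  \<comment> \<open>The difference quotient of \<open>h\<close> splits into the quotient
    \<open>q\<close> relative to a rotation about the origin and the contribution of that
    rotation.\<close>
  have "((\<lambda>\<epsilon>. q \<epsilon> * (sin \<epsilon> / \<epsilon>) + h \<theta> * ((cos \<epsilon> - 1) / \<epsilon>)) \<longlongrightarrow> mid \<theta> * 1 + h \<theta> * 0) (at 0)"
    by (intro tendsto_intros q l)
  moreover have "\<forall>\<^sub>F \<epsilon> in at 0. q \<epsilon> * (sin \<epsilon> / \<epsilon>) + h \<theta> * ((cos \<epsilon> - 1) / \<epsilon>) = (h (\<theta> + \<epsilon>) - h \<theta>) / \<epsilon>"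
    unfolding eventually_at
  proof (intro exI[of _ 1] conjI ballI impI)
    fix \<epsilon> :: real assume \<epsilon>: "\<epsilon> \<noteq> 0 \<and> dist \<epsilon> 0 < 1"
    then have "sin \<epsilon> \<noteq> 0" using sin_pos[of \<epsilon>] sin_pos[of "- \<epsilon>"] by (cases "\<epsilon> > 0") (auto simp: dist_real_def)
    then show "q \<epsilon> * (sin \<epsilon> / \<epsilon>) + h \<theta> * ((cos \<epsilon> - 1) / \<epsilon>) = (h (\<theta> + \<epsilon>) - h \<theta>) / \<epsilon>"
      using \<epsilon> by (simp add: q_def divide_simps algebra_simps)
  qed simp
  ultimately have "((\<lambda>\<epsilon>. (h (\<theta> + \<epsilon>) - h \<theta>) / \<epsilon>) \<longlongrightarrow> mid \<theta>) (at 0)"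
    using Lim_transform_eventually by fastforce
  then show ?thesis by (simp add: DERIV_def)
qed

lemma continuous_h: "continuous_on UNIV h"
  using DERIV_h by (auto intro!: continuous_at_imp_continuous_on DERIV_isCont)

lemma continuous_b: "continuous_on UNIV bp" "continuous_on UNIV bm"
proof -
  have c: "continuous_on UNIV (\<lambda>\<theta>. h \<theta> *\<^sub>R dir \<theta>)"
    by (intro continuous_intros continuous_h continuous_on_dir)
  have "\<exists>s. h \<theta> *\<^sub>R dir \<theta> + s *\<^sub>R tng \<theta> \<in> interior K" for \<theta>
    using chord_interior[of \<theta>] by (metis pnt_def)
  then show "continuous_on UNIV bp"
    unfolding bp_def by (intro continuous_on_reach K c continuous_on_dir) auto
  have "\<exists>s. h \<theta> *\<^sub>R dir \<theta> + s *\<^sub>R (- tng \<theta>) \<in> interior K" for \<theta>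
  proof -
    obtain s where "pnt \<theta> s \<in> interior K" by (rule chord_interior)
    then show ?thesis by (intro exI[of _ "- s"]) (simp add: pnt_def)
  qed
  then show "continuous_on UNIV bm"
    unfolding bm_def
    by (intro continuous_on_minus continuous_on_reach K c continuous_on_dir) auto
qed

end

section \<open>Motion of the endpoints and poles\<close>

context flotation
begin

text \<open>The tangent at the endpoint \<open>b \<theta>\<close> of the chord has normal \<open>tng \<theta> + slope b \<theta> *\<^sub>R dir \<theta>\<close>.\<close>
definition slope :: "(real \<Rightarrow> real) \<Rightarrow> real \<Rightarrow> real" where
  "slope b \<theta> = (normal K (pnt \<theta> (b \<theta>)) \<bullet> dir \<theta>) / (normal K (pnt \<theta> (b \<theta>)) \<bullet> tng \<theta>)"

lemma continuous_pnt:
  assumes "continuous_on UNIV b"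
  shows "continuous_on UNIV (\<lambda>\<theta>. pnt \<theta> (b \<theta>))"
  unfolding pnt_def by (intro continuous_intros continuous_h continuous_on_dir assms)

lemma continuous_normal_pnt:
  assumes "continuous_on UNIV b" "\<And>\<theta>. pnt \<theta> (b \<theta>) \<in> frontier K"
  shows "continuous_on UNIV (\<lambda>\<theta>. normal K (pnt \<theta> (b \<theta>)))"
  by (rule continuous_on_compose2[OF continuous_on_normal[OF smooth] continuous_pnt[OF assms(1)]])
     (use assms(2) in auto)

lemma continuous_slope:
  assumes "continuous_on UNIV b" "\<And>\<theta>. pnt \<theta> (b \<theta>) \<in> frontier K"
    and "\<And>\<theta>. normal K (pnt \<theta> (b \<theta>)) \<bullet> tng \<theta> \<noteq> 0"
  shows "continuous_on UNIV (slope b)"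
  unfolding slope_def
  by (intro continuous_intros continuous_normal_pnt assms continuous_on_dir) (use assms in auto)

text \<open>The supporting lines at the old and the new endpoint enclose the displacement
  of the endpoint, and their directions agree in the limit.\<close>
lemma DERIV_endpoint:
  assumes b: "continuous_on UNIV b" and fr: "\<And>\<theta>. pnt \<theta> (b \<theta>) \<in> frontier K"
    and nz: "normal K (pnt \<theta> (b \<theta>)) \<bullet> tng \<theta> \<noteq> 0"
  shows "(b has_real_derivative - h \<theta> - slope b \<theta> * (mid \<theta> - b \<theta>)) (at \<theta>)"
proof -
  define B where "B \<phi> = pnt \<phi> (b \<phi>)" for \<phi>
  define N where "N \<phi> = normal K (B \<phi>)" for \<phi>
  define n where "n = dir \<theta>"
  define u where "u = tng \<theta>"
  define r where "r = slope b \<theta>"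
  define \<rho> where "\<rho> \<phi> = (N \<phi> \<bullet> n) / (N \<phi> \<bullet> u)" for \<phi>
  define Dv where "Dv \<phi> = n \<bullet> (B \<phi> - B \<theta>)" for \<phi>
  define Ds where "Ds \<phi> = u \<bullet> (B \<phi> - B \<theta>)" for \<phi>
  have r_eq: "r = \<rho> \<theta>" by (simp add: r_def slope_def \<rho>_def N_def B_def n_def u_def)
  have nz': "N \<theta> \<bullet> u \<noteq> 0" using nz by (simp add: N_def B_def u_def)
  have contN: "(N \<longlongrightarrow> N \<theta>) (at \<theta>)"
    using continuous_normal_pnt[OF b fr] unfolding N_def B_def continuous_on_def by simp
  have contb: "(b \<longlongrightarrow> b \<theta>) (at \<theta>)" using b by (simp add: continuous_on_def)
  have lim\<rho>: "(\<rho> \<longlongrightarrow> r) (at \<theta>)"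
    unfolding r_eq unfolding \<rho>_def by (intro tendsto_intros contN nz')
  have exp: "M \<bullet> (B \<phi> - B \<theta>) = (M \<bullet> n) * Dv \<phi> + (M \<bullet> u) * Ds \<phi>" for M \<phi>
  proof -
    have "B \<phi> - B \<theta> = Dv \<phi> *\<^sub>R n + Ds \<phi> *\<^sub>R u"
      unfolding Dv_def Ds_def n_def u_def by (rule frame_expand[OF frame_dir])
    then show ?thesis by (simp add: inner_add_right)
  qed
  have BK: "B \<phi> \<in> K" for \<phi> using fr K(4) frontier_subset_closed by (auto simp: B_def)
  have supp: "supports K (B \<phi>) (N \<phi>)" for \<phi>
    unfolding N_def B_def by (rule supports_normal[OF K(1) fr])
  \<comment> \<open>Near \<open>\<theta>\<close> the tangential components of the normals keep their
    sign, so both supporting inequalities can be divided by them.\<close>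
  have ev: "\<forall>\<^sub>F \<phi> in at \<theta>. (N \<phi> \<bullet> u) * (N \<theta> \<bullet> u) > 0"
  proof (rule order_tendstoD)
    show "((\<lambda>\<phi>. (N \<phi> \<bullet> u) * (N \<theta> \<bullet> u)) \<longlongrightarrow> (N \<theta> \<bullet> u) * (N \<theta> \<bullet> u)) (at \<theta>)"
      by (intro tendsto_intros contN)
    show "0 < (N \<theta> \<bullet> u) * (N \<theta> \<bullet> u)" using nz' by (auto simp: zero_less_mult_iff)
  qed
  \<comment> \<open>Support at the old endpoint and support at the new one give
    \<open>Ds \<phi> + r * Dv \<phi>\<close> and
    \<open>Ds \<phi> + \<rho> \<phi> * Dv \<phi>\<close> opposite signs. Each is therefore bounded
    by their difference.\<close>
  have X: "\<bar>Ds \<phi> + r * Dv \<phi>\<bar> \<le> \<bar>\<rho> \<phi> - r\<bar> * \<bar>Dv \<phi>\<bar>" if "(N \<phi> \<bullet> u) * (N \<theta> \<bullet> u) > 0" for \<phi>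
  proof -
    have "N \<theta> \<bullet> (B \<phi> - B \<theta>) \<le> 0" using supp[of \<theta>] BK[of \<phi>] by (simp add: supports_def)
    then have 1: "(N \<theta> \<bullet> u) * (Ds \<phi> + r * Dv \<phi>) \<le> 0"
      using nz' unfolding exp r_eq \<rho>_def by (simp add: algebra_simps)
    have "N \<phi> \<bullet> (B \<theta> - B \<phi>) \<le> 0" using supp[of \<phi>] BK[of \<theta>] by (simp add: supports_def)
    then have "N \<phi> \<bullet> (B \<phi> - B \<theta>) \<ge> 0" by (simp add: inner_diff_right)
    moreover have "N \<phi> \<bullet> u \<noteq> 0" using that by auto
    ultimately have 2: "(N \<phi> \<bullet> u) * (Ds \<phi> + \<rho> \<phi> * Dv \<phi>) \<ge> 0"
      unfolding exp \<rho>_def by (simp add: algebra_simps)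
    have "\<bar>Ds \<phi> + r * Dv \<phi>\<bar> \<le> \<bar>(\<rho> \<phi> - r) * Dv \<phi>\<bar>"
    proof (cases "N \<theta> \<bullet> u > 0")
      case True
      then have "N \<phi> \<bullet> u > 0" using that by (simp add: zero_less_mult_iff)
      then have "Ds \<phi> + \<rho> \<phi> * Dv \<phi> \<ge> 0" "Ds \<phi> + r * Dv \<phi> \<le> 0"
        using 1 2 True by (auto simp: mult_le_0_iff zero_le_mult_iff)
      then show ?thesis by (simp add: left_diff_distrib)
    next
      case False
      then have lt: "N \<phi> \<bullet> u < 0" "N \<theta> \<bullet> u < 0" using that by (auto simp: zero_less_mult_iff)
      then have "Ds \<phi> + \<rho> \<phi> * Dv \<phi> \<le> 0" "Ds \<phi> + r * Dv \<phi> \<ge> 0"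
        using 1 2 by (auto simp: mult_le_0_iff zero_le_mult_iff)
      then show ?thesis by (simp add: left_diff_distrib)
    qed
    then show ?thesis by (simp add: abs_mult)
  qed
  have nB: "n \<bullet> B \<phi> = h \<phi> * cos (\<phi> - \<theta>) - b \<phi> * sin (\<phi> - \<theta>)" for \<phi>
    by (simp add: B_def n_def pnt_def inner_add_right dir_inner_dir)
  \<comment> \<open>The displacement is measured in the fixed frame at \<open>\<theta>\<close>; this
    returns to the moving frame, where \<open>b \<phi>\<close> is the tangential coordinate.\<close>
  have uB: "b \<phi> = cos (\<phi> - \<theta>) * (u \<bullet> B \<phi>) - sin (\<phi> - \<theta>) * (n \<bullet> B \<phi>)" for \<phi>
  proof -
    have "u \<bullet> B \<phi> = h \<phi> * sin (\<phi> - \<theta>) + b \<phi> * cos (\<phi> - \<theta>)"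
      by (simp add: B_def u_def pnt_def inner_add_right dir_inner_dir)
    then have "cos (\<phi> - \<theta>) * (u \<bullet> B \<phi>) - sin (\<phi> - \<theta>) * (n \<bullet> B \<phi>)
       = b \<phi> * ((sin (\<phi> - \<theta>))\<^sup>2 + (cos (\<phi> - \<theta>))\<^sup>2)"
      unfolding nB by algebra
    then show ?thesis by simp
  qed
  have "((\<lambda>\<phi>. h \<phi> * cos (\<phi> - \<theta>)) has_real_derivative mid \<theta>) (at \<theta>)"
    by (auto intro!: derivative_eq_intros DERIV_h)
  then have q1: "((\<lambda>\<phi>. (h \<phi> * cos (\<phi> - \<theta>) - h \<theta>) / (\<phi> - \<theta>)) \<longlongrightarrow> mid \<theta>) (at \<theta>)"
    by (simp add: has_field_derivative_iff)
  have "((\<lambda>\<phi>. sin (\<phi> - \<theta>)) has_real_derivative 1) (at \<theta>)"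
    by (auto intro!: derivative_eq_intros)
  then have q2: "((\<lambda>\<phi>. sin (\<phi> - \<theta>) / (\<phi> - \<theta>)) \<longlongrightarrow> 1) (at \<theta>)"
    by (simp add: has_field_derivative_iff)
  have "((\<lambda>\<phi>. (h \<phi> * cos (\<phi> - \<theta>) - h \<theta>) / (\<phi> - \<theta>) - b \<phi> * (sin (\<phi> - \<theta>) / (\<phi> - \<theta>)))
      \<longlongrightarrow> mid \<theta> - b \<theta> * 1) (at \<theta>)"
    by (intro tendsto_intros q1 q2 contb)
  moreover have "(h \<phi> * cos (\<phi> - \<theta>) - h \<theta>) / (\<phi> - \<theta>) - b \<phi> * (sin (\<phi> - \<theta>) / (\<phi> - \<theta>)) = Dv \<phi> / (\<phi> - \<theta>)" for \<phi>
    unfolding Dv_def inner_diff_right nB by (simp add: diff_divide_distrib)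
  ultimately have limv: "((\<lambda>\<phi>. Dv \<phi> / (\<phi> - \<theta>)) \<longlongrightarrow> mid \<theta> - b \<theta>) (at \<theta>)" by simp
  have "((\<lambda>\<phi>. \<bar>\<rho> \<phi> - r\<bar> * \<bar>Dv \<phi> / (\<phi> - \<theta>)\<bar>) \<longlongrightarrow> \<bar>r - r\<bar> * \<bar>mid \<theta> - b \<theta>\<bar>) (at \<theta>)"
    by (intro tendsto_intros lim\<rho> limv)
  then have bound: "((\<lambda>\<phi>. \<bar>\<rho> \<phi> - r\<bar> * \<bar>Dv \<phi> / (\<phi> - \<theta>)\<bar>) \<longlongrightarrow> 0) (at \<theta>)" by simp
  have "((\<lambda>\<phi>. (Ds \<phi> + r * Dv \<phi>) / (\<phi> - \<theta>)) \<longlongrightarrow> 0) (at \<theta>)"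
  proof (rule Lim_null_comparison[OF _ bound])
    show "\<forall>\<^sub>F \<phi> in at \<theta>. norm ((Ds \<phi> + r * Dv \<phi>) / (\<phi> - \<theta>)) \<le> \<bar>\<rho> \<phi> - r\<bar> * \<bar>Dv \<phi> / (\<phi> - \<theta>)\<bar>"
      using ev
    proof eventually_elim
      case (elim \<phi>)
      show ?case using divide_right_mono[OF X[OF elim], of "\<bar>\<phi> - \<theta>\<bar>"] by (simp add: abs_mult)
    qed
  qed
  \<comment> \<open>To first order the endpoint moves along the tangent, so its velocity along
    \<open>u\<close> is \<open>- r\<close> times its velocity along \<open>n\<close>.\<close>
  then have "((\<lambda>\<phi>. (Ds \<phi> + r * Dv \<phi>) / (\<phi> - \<theta>) - r * (Dv \<phi> / (\<phi> - \<theta>))) \<longlongrightarrow> 0 - r * (mid \<theta> - b \<theta>)) (at \<theta>)"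
    by (intro tendsto_intros limv)
  then have "((\<lambda>\<phi>. Ds \<phi> / (\<phi> - \<theta>)) \<longlongrightarrow> - r * (mid \<theta> - b \<theta>)) (at \<theta>)"
    by (simp add: add_divide_distrib)
  then have du: "((\<lambda>\<phi>. u \<bullet> B \<phi>) has_real_derivative - r * (mid \<theta> - b \<theta>)) (at \<theta>)"
    by (simp add: has_field_derivative_iff Ds_def inner_diff_right)
  have dn: "((\<lambda>\<phi>. n \<bullet> B \<phi>) has_real_derivative mid \<theta> - b \<theta>) (at \<theta>)"
    using limv by (simp add: has_field_derivative_iff Dv_def inner_diff_right)
  have "((\<lambda>\<phi>. cos (\<phi> - \<theta>) * (u \<bullet> B \<phi>) - sin (\<phi> - \<theta>) * (n \<bullet> B \<phi>)) has_real_derivative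
      - r * (mid \<theta> - b \<theta>) - n \<bullet> B \<theta>) (at \<theta>)"
    by (auto intro!: derivative_eq_intros du dn)
  moreover have "n \<bullet> B \<theta> = h \<theta>" by (simp add: n_def B_def dir_pnt)
  ultimately show ?thesis
    unfolding uB[symmetric] by (simp add: r_def algebra_simps)
qed

lemma normal_tng_bp: "normal K (pnt \<theta> (bp \<theta>)) \<bullet> tng \<theta> > 0"
  and normal_tng_bm: "normal K (pnt \<theta> (bm \<theta>)) \<bullet> tng \<theta> < 0"
proof -
  have lt: "bm \<theta> < mid \<theta>" "mid \<theta> < bp \<theta>" using bm_less_bp[of \<theta>] by (auto simp: mid_def)
  then have i: "pnt \<theta> (mid \<theta>) \<in> interior K" by (rule chord_interior_mem)
  have d: "pnt \<theta> s - pnt \<theta> t = (s - t) *\<^sub>R tng \<theta>" for s t by (simp add: pnt_def algebra_simps)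
  have nz: "normal K q \<noteq> 0" if "q \<in> frontier K" for q
    using norm_normal[OF K(1) that] by auto
  have "normal K (pnt \<theta> (bp \<theta>)) \<bullet> (pnt \<theta> (mid \<theta>) - pnt \<theta> (bp \<theta>)) < 0"
    using supports_interior[OF supports_normal[OF K(1) chord_frontier(1)] nz[OF chord_frontier(1)] i] .
  then show "normal K (pnt \<theta> (bp \<theta>)) \<bullet> tng \<theta> > 0"
    using lt by (simp add: d mult_less_0_iff)
  have "normal K (pnt \<theta> (bm \<theta>)) \<bullet> (pnt \<theta> (mid \<theta>) - pnt \<theta> (bm \<theta>)) < 0"
    using supports_interior[OF supports_normal[OF K(1) chord_frontier(2)] nz[OF chord_frontier(2)] i] .
  then show "normal K (pnt \<theta> (bm \<theta>)) \<bullet> tng \<theta> < 0"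
    using lt by (simp add: d mult_less_0_iff)
qed

text \<open>As \<open>mid\<close> is the derivative of \<open>h\<close>, the last summand is
  \<open>h + h''\<close>, the radius of curvature of the envelope, here in terms of the tangents at
  the endpoints.\<close>

lemma DERIV_mid:
  "(mid has_real_derivative - h \<theta> + hw \<theta> * (slope bp \<theta> - slope bm \<theta>) / 2) (at \<theta>)"
proof -
  have "(bp has_real_derivative - h \<theta> - slope bp \<theta> * (mid \<theta> - bp \<theta>)) (at \<theta>)"
    using normal_tng_bp[of \<theta>] by (intro DERIV_endpoint continuous_b chord_frontier) auto
  moreover have "(bm has_real_derivative - h \<theta> - slope bm \<theta> * (mid \<theta> - bm \<theta>)) (at \<theta>)"
    using normal_tng_bm[of \<theta>] by (intro DERIV_endpoint continuous_b chord_frontier) auto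
  ultimately have d: "((\<lambda>\<theta>. (bp \<theta> + bm \<theta>) / 2) has_real_derivative
     ((- h \<theta> - slope bp \<theta> * (mid \<theta> - bp \<theta>)) + (- h \<theta> - slope bm \<theta> * (mid \<theta> - bm \<theta>))) / 2) (at \<theta>)"
    by (intro DERIV_cdivide DERIV_add)
  have e: "mid \<theta> - bp \<theta> = - hw \<theta>" "mid \<theta> - bm \<theta> = hw \<theta>"
    by (auto simp: mid_def hw_def field_simps)
  have d': "((- h \<theta> - slope bp \<theta> * (mid \<theta> - bp \<theta>)) + (- h \<theta> - slope bm \<theta> * (mid \<theta> - bm \<theta>))) / 2
      = - h \<theta> + hw \<theta> * (slope bp \<theta> - slope bm \<theta>) / 2"
    unfolding e by (simp add: field_simps)
  have "mid = (\<lambda>\<theta>. (bp \<theta> + bm \<theta>) / 2)" by (simp add: fun_eq_iff mid_def)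
  then show ?thesis using d unfolding d' by metis
qed

lemma continuous_slope_diff: "continuous_on UNIV (\<lambda>\<theta>. slope bp \<theta> - slope bm \<theta>)"
proof -
  have "continuous_on UNIV (slope bp)"
    by (intro continuous_slope continuous_b chord_frontier) (use normal_tng_bp in \<open>metis less_irrefl\<close>)
  moreover have "continuous_on UNIV (slope bm)"
    by (intro continuous_slope continuous_b chord_frontier) (use normal_tng_bm in \<open>metis less_irrefl\<close>)
  ultimately show ?thesis by (intro continuous_intros)
qed

section \<open>Poles and their signed height over the chord\<close>

lemma tangent_line_normal:
  assumes "q \<in> frontier K" "p \<in> tangent_line K q"
  shows "normal K q \<bullet> (p - q) = 0"
proof -
  obtain v where v: "v \<noteq> 0" "\<forall>y\<in>K. v \<bullet> (y - q) \<le> 0" "v \<bullet> (p - q) = 0"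
    using assms(2) by (auto simp: tangent_line_def)
  have "norm (sgn v) = 1" "supports K q (sgn v)"
    using v by (auto simp: norm_sgn supports_def sgn_div_norm mult_le_0_iff)
  then have "normal K q = sgn v"
    using normal_props[OF K(1) assms(1)] smooth assms(1) unfolding smooth_body_def by blast
  then show ?thesis using v(3) by (simp add: sgn_div_norm)
qed

definition pole :: "real \<Rightarrow> pt \<Rightarrow> bool" where
  "pole \<theta> p \<longleftrightarrow> is_pole K (flot_line K \<delta> (dir \<theta>)) p"

definition height :: "real \<Rightarrow> pt \<Rightarrow> real" where
  "height \<theta> p = dir \<theta> \<bullet> p - h \<theta>"

lemma pnt_flot_line: "pnt \<theta> s \<in> flot_line K \<delta> (dir \<theta>)"
  using dir_pnt[of \<theta> s] by (simp add: flot_line_def h_def)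

lemma pole_eqs:
  assumes "pole \<theta> p"
  shows "tng \<theta> \<bullet> p - bp \<theta> + slope bp \<theta> * height \<theta> p = 0"
    and "tng \<theta> \<bullet> p - bm \<theta> + slope bm \<theta> * height \<theta> p = 0"
proof -
  have *: "tng \<theta> \<bullet> p - b \<theta> + slope b \<theta> * height \<theta> p = 0"
    if fr: "pnt \<theta> (b \<theta>) \<in> frontier K" and nz: "normal K (pnt \<theta> (b \<theta>)) \<bullet> tng \<theta> \<noteq> 0" for b
  proof -
    let ?N = "normal K (pnt \<theta> (b \<theta>))"
    have "p \<in> tangent_line K (pnt \<theta> (b \<theta>))"
      using assms fr pnt_flot_line by (auto simp: pole_def is_pole_def)
    then have "?N \<bullet> (p - pnt \<theta> (b \<theta>)) = 0" by (rule tangent_line_normal[OF fr])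
    moreover have "p - pnt \<theta> (b \<theta>) = height \<theta> p *\<^sub>R dir \<theta> + (tng \<theta> \<bullet> p - b \<theta>) *\<^sub>R tng \<theta>"
    proof -
      have "p = (dir \<theta> \<bullet> p) *\<^sub>R dir \<theta> + (tng \<theta> \<bullet> p) *\<^sub>R tng \<theta>" by (rule frame_expand[OF frame_dir])
      then have "p - pnt \<theta> (b \<theta>) = (dir \<theta> \<bullet> p) *\<^sub>R dir \<theta> + (tng \<theta> \<bullet> p) *\<^sub>R tng \<theta> - pnt \<theta> (b \<theta>)" by simp
      then show ?thesis by (simp add: pnt_def height_def algebra_simps)
    qed
    ultimately have "height \<theta> p * (?N \<bullet> dir \<theta>) + (tng \<theta> \<bullet> p - b \<theta>) * (?N \<bullet> tng \<theta>) = 0"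
      by (simp add: inner_add_right)
    then show ?thesis using nz by (simp add: slope_def field_simps)
  qed
  show "tng \<theta> \<bullet> p - bp \<theta> + slope bp \<theta> * height \<theta> p = 0"
    using *[of bp] chord_frontier normal_tng_bp[of \<theta>] by simp
  show "tng \<theta> \<bullet> p - bm \<theta> + slope bm \<theta> * height \<theta> p = 0"
    using *[of bm] chord_frontier normal_tng_bm[of \<theta>] by simp
qed

text \<open>Subtracting the two tangent equations removes the tangential coordinate of the pole.
  Since \<open>hw\<close> is positive, neither factor on the left vanishes.\<close>

lemma slope_diff_height:
  assumes "pole \<theta> p"
  shows "(slope bp \<theta> - slope bm \<theta>) * height \<theta> p = 2 * hw \<theta>"
  using pole_eqs[OF assms] by (simp add: hw_def algebra_simps)

text \<open>The slope difference is continuous and vanishes nowhere, so it has one sign on the whole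
  line of angles, and the height of each pole shares it.\<close>

lemma height_sign_cases:
  assumes ex: "\<And>\<theta>. \<exists>p. pole \<theta> p"
  shows "(\<forall>\<theta> p. pole \<theta> p \<longrightarrow> height \<theta> p > 0) \<or> (\<forall>\<theta> p. pole \<theta> p \<longrightarrow> height \<theta> p < 0)"
proof -
  let ?D = "\<lambda>\<theta>. slope bp \<theta> - slope bm \<theta>"
  have nz: "?D \<theta> \<noteq> 0" for \<theta>
    using ex[of \<theta>] slope_diff_height hw_pos[of \<theta>] by force
  have "(\<forall>\<theta>. ?D \<theta> > 0) \<or> (\<forall>\<theta>. ?D \<theta> < 0)"
  proof (rule ccontr)
    assume "\<not> ?thesis"
    then obtain s t where st: "?D s < 0" "?D t > 0" using nz by (meson linorder_neqE)
    have "is_interval (range ?D)"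
      unfolding is_interval_connected_1
      by (intro connected_continuous_image continuous_slope_diff connected_UNIV)
    then have "0 \<in> range ?D"
      by (rule mem_is_interval_1_I[of _ "?D s" "?D t"]) (use st in auto)
    then show False using nz by auto
  qed
  moreover have "?D \<theta> * height \<theta> p > 0" if "pole \<theta> p" for \<theta> p
    using slope_diff_height[OF that] hw_pos[of \<theta>] by simp
  ultimately show ?thesis by (meson zero_less_mult_pos mult_neg_pos mult_pos_neg not_less_iff_gr_or_eq zero_less_mult_iff less_asym)
qed

end

section \<open>The Ermakov equation and ellipses\<close>

text \<open>The energy \<open>G\<close> is a first integral. With its help the nonlinear equation
  for \<open>y\<close> becomes a linear oscillator of frequency 2 for \<open>y\<close>
  squared.\<close>

lemma ermakov_solution:
  fixes y y1 :: "real \<Rightarrow> real"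
  assumes pos: "\<And>\<theta>. y \<theta> > 0" and dy: "\<And>\<theta>. (y has_real_derivative y1 \<theta>) (at \<theta>)"
    and dy1: "\<And>\<theta>. (y1 has_real_derivative - y \<theta> + \<kappa> / (y \<theta>) ^ 3) (at \<theta>)"
  obtains E \<alpha> \<beta> where "\<And>\<theta>. (y \<theta>)\<^sup>2 = E + \<alpha> * cos (2 * \<theta>) + \<beta> * sin (2 * \<theta>)"
    "\<And>\<theta>. y \<theta> * y1 \<theta> = - \<alpha> * sin (2 * \<theta>) + \<beta> * cos (2 * \<theta>)"
proof -
  have nz: "y \<theta> \<noteq> 0" for \<theta> using pos[of \<theta>] by simp
  define G where "G \<theta> = (y1 \<theta>)\<^sup>2 + (y \<theta>)\<^sup>2 + \<kappa> / (y \<theta>)\<^sup>2" for \<theta>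
  have "(G has_real_derivative 0) (at \<theta>)" for \<theta>
    unfolding G_def
    by (rule derivative_eq_intros dy dy1 refl | simp add: nz)+
       (use nz[of \<theta>] in \<open>simp add: field_simps power2_eq_square power3_eq_cube power4_eq_xxxx\<close>)
  then have G: "G \<theta> = G 0" for \<theta> using DERIV_isconst_all by blast
  \<comment> \<open>The second derivative of \<open>y\<close> squared is twice
    \<open>G \<theta> - 2 * (y \<theta>)\<^sup>2\<close>, so \<open>G 0 / 2\<close> is the
    equilibrium.\<close>
  define E where "E = G 0 / 2"
  define Z where "Z \<theta> = (y \<theta>)\<^sup>2 - E" for \<theta>
  define Z1 where "Z1 \<theta> = y \<theta> * y1 \<theta>" for \<theta>
  have dZ: "(Z has_real_derivative 2 * Z1 \<theta>) (at \<theta>)" for \<theta>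
    unfolding Z_def Z1_def by (auto intro!: derivative_eq_intros dy)
  have dZ1: "(Z1 has_real_derivative - 2 * Z \<theta>) (at \<theta>)" for \<theta>
  proof -
    have "(Z1 has_real_derivative y1 \<theta> * y1 \<theta> + (- y \<theta> + \<kappa> / (y \<theta>) ^ 3) * y \<theta>) (at \<theta>)"
      unfolding Z1_def by (intro DERIV_mult dy dy1)
    moreover have "y1 \<theta> * y1 \<theta> + (- y \<theta> + \<kappa> / (y \<theta>) ^ 3) * y \<theta> = G \<theta> - 2 * (y \<theta>)\<^sup>2"
      using nz[of \<theta>] by (simp add: G_def field_simps power2_eq_square power3_eq_cube)
    ultimately show ?thesis using G[of \<theta>] by (simp add: Z_def E_def)
  qed
  \<comment> \<open>The pair \<open>Z\<close>, \<open>Z1\<close> turns by the angle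
    \<open>- 2 * \<theta>\<close>; turning it back leaves the constants of integration.\<close>
  define A where "A \<theta> = Z \<theta> * cos (2 * \<theta>) - Z1 \<theta> * sin (2 * \<theta>)" for \<theta>
  define B where "B \<theta> = Z \<theta> * sin (2 * \<theta>) + Z1 \<theta> * cos (2 * \<theta>)" for \<theta>
  have "(A has_real_derivative 0) (at \<theta>)" "(B has_real_derivative 0) (at \<theta>)" for \<theta>
    unfolding A_def B_def by (auto intro!: derivative_eq_intros dZ dZ1)
  then have AB: "A \<theta> = A 0" "B \<theta> = B 0" for \<theta> using DERIV_isconst_all by blast+
  have sc: "(sin (2 * \<theta>))\<^sup>2 + (cos (2 * \<theta>))\<^sup>2 = 1" for \<theta> :: real by simp
  have "Z \<theta> = A \<theta> * cos (2 * \<theta>) + B \<theta> * sin (2 * \<theta>)"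
       "Z1 \<theta> = - A \<theta> * sin (2 * \<theta>) + B \<theta> * cos (2 * \<theta>)" for \<theta>
    using sc[of \<theta>] unfolding A_def B_def by algebra+
  then have "Z \<theta> = A 0 * cos (2 * \<theta>) + B 0 * sin (2 * \<theta>)"
       "Z1 \<theta> = - A 0 * sin (2 * \<theta>) + B 0 * cos (2 * \<theta>)" for \<theta>
    by (metis AB)+
  then show thesis
    by (intro that[of E "A 0" "B 0"]) (auto simp: Z_def Z1_def algebra_simps)
qed

text \<open>Chords between antipodal points of the image of the unit circle fill the elliptical
  disc, so it is contained in \<open>K\<close> and \<open>c\<close> is interior. If \<open>K\<close>
  went beyond the disc, a segment to \<open>c\<close> would make a point of this image interior,
  although it is in the frontier.\<close>

lemma is_ellipseI:
  fixes f :: "pt \<Rightarrow> pt"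
  assumes K: "compact K" "convex K" and f: "linear f" "inj f"
    and fr: "\<And>e. norm e = 1 \<Longrightarrow> c + f e \<in> frontier K"
  shows "is_ellipse K"
proof -
  let ?G = "\<lambda>x. c + f x"
  have fK: "frontier K \<subseteq> K" using K by (simp add: compact_imp_closed frontier_subset_closed)
  have sub: "?G x \<in> K" if "norm x \<le> 1" for x
  proof (cases "x = 0")
    case False
    define e where "e = sgn x"
    have e: "norm e = 1" using False by (simp add: e_def norm_sgn)
    have "norm x *\<^sub>R e = x" using False by (simp add: e_def sgn_div_norm)
    then have fx: "f x = norm x *\<^sub>R f e" using linear_scale[OF f(1)] by metis
    have "?G e \<in> K" "?G (- e) \<in> K" using fr[of e] fr[of "- e"] e fK by auto
    then have "((1 - norm x) / 2) *\<^sub>R ?G (- e) + ((1 + norm x) / 2) *\<^sub>R ?G e \<in> K"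
      using that by (intro convexD K) (auto simp: field_simps)
    moreover have "((1 - norm x) / 2) *\<^sub>R ?G (- e) + ((1 + norm x) / 2) *\<^sub>R ?G e = ?G x"
    proof -
      have "((1 - norm x) / 2) *\<^sub>R ?G (- e) + ((1 + norm x) / 2) *\<^sub>R ?G e
          = ((1 - norm x) / 2 + (1 + norm x) / 2) *\<^sub>R c + ((1 + norm x) / 2 - (1 - norm x) / 2) *\<^sub>R f e"
        by (simp add: linear_neg[OF f(1)] algebra_simps)
      also have "\<dots> = c + norm x *\<^sub>R f e" by (simp add: field_simps)
      finally show ?thesis by (simp add: fx)
    qed
    ultimately show ?thesis by simp
  next
    case True
    obtain e :: pt where e: "norm e = 1" using vector_choose_size[of 1] by auto
    have "?G e \<in> K" "?G (- e) \<in> K" using fr[of e] fr[of "- e"] e fK by auto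
    then have "(1 / 2) *\<^sub>R ?G (- e) + (1 / 2) *\<^sub>R ?G e \<in> K"
      by (intro convexD K) auto
    moreover have "(1 / 2) *\<^sub>R ?G (- e) + (1 / 2) *\<^sub>R ?G e = (1 / 2 + 1 / 2) *\<^sub>R c"
      unfolding scaleR_add_left by (simp add: linear_neg[OF f(1)] scaleR_add_right scaleR_diff_right)
    ultimately show ?thesis using True f(1) by (simp add: linear_0)
  qed
  have "surj f" using f by (simp add: linear_injective_imp_surjective)
  have "open (f ` ball 0 1)"
    by (rule open_surjective_linear_image) (use f \<open>surj f\<close> in auto)
  then have "open ((+) c ` f ` ball 0 1)" by (rule open_translation)
  moreover have "(+) c ` f ` ball 0 1 \<subseteq> K" using sub by auto
  moreover have "c \<in> (+) c ` f ` ball 0 1"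
    using f(1) by (auto simp: image_iff linear_0 intro!: bexI[of _ 0])
  ultimately have ci: "c \<in> interior K" by (meson interiorI)
  have "x \<in> ?G ` cball 0 1" if "x \<in> K" for x
  proof -
    obtain z where z: "f z = x - c" using \<open>surj f\<close> by (metis surjD)
    have "norm z \<le> 1"
    proof (rule ccontr)
      assume "\<not> norm z \<le> 1"
      then have gt: "norm z > 1" by simp
      \<comment> \<open>Scaling by \<open>t\<close> brings \<open>z\<close> onto the unit
        circle.\<close>
      define t where "t = 1 / norm z"
      have t: "0 < t" "t < 1" using gt by (auto simp: t_def divide_less_eq_1)
      have "x - (1 - t) *\<^sub>R (x - c) \<in> interior K"
        by (rule mem_interior_convex_shrink[OF K(2) ci that]) (use t in auto)
      moreover have "x - (1 - t) *\<^sub>R (x - c) = ?G (t *\<^sub>R z)"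
        by (simp add: linear_scale[OF f(1)] z algebra_simps)
      moreover have "norm (t *\<^sub>R z) = 1" using gt t unfolding t_def norm_scaleR by auto
      ultimately show False using fr by (metis Diff_iff frontier_def)
    qed
    then show ?thesis using z by (intro image_eqI[of _ _ z]) auto
  qed
  then have "K = ?G ` cball 0 1" using sub by auto
  then show ?thesis unfolding is_ellipse_def using f by blast
qed

text \<open>By Cholesky factorisation, \<open>y \<theta>\<close> is the norm of a linear image of \<open>dir \<theta>\<close>.\<close>
lemma is_ellipse_from_quadratic_form:
  fixes y :: "real \<Rightarrow> real" and P :: "real \<Rightarrow> pt"
  assumes K: "compact K" "convex K" and pos: "\<And>\<theta>. y \<theta> > 0" and fr: "\<And>\<theta>. P \<theta> \<in> frontier K"
    and y: "\<And>\<theta>. (y \<theta>)\<^sup>2 = E + \<alpha> * cos (2 * \<theta>) + \<beta> * sin (2 * \<theta>)"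
    and P: "\<And>\<theta>. y \<theta> *\<^sub>R (P \<theta> - m) =
      s *\<^sub>R ((y \<theta>)\<^sup>2 *\<^sub>R dir \<theta> + (- \<alpha> * sin (2 * \<theta>) + \<beta> * cos (2 * \<theta>) + k) *\<^sub>R tng \<theta>)"
    and s: "s \<noteq> 0"
  shows "is_ellipse K"
proof -
  define Q where "Q z = (E + \<alpha>) * (z $ 1)\<^sup>2 + 2 * \<beta> * z $ 1 * z $ 2 + (E - \<alpha>) * (z $ 2)\<^sup>2" for z :: pt
  \<comment> \<open>Up to the factor \<open>s\<close>, the matrix of \<open>Q\<close> plus
    \<open>k\<close> times the rotation by a right angle: the former sends
    \<open>dir \<theta>\<close> to its value \<open>(y \<theta>)\<^sup>2\<close> along
    \<open>dir\<close> plus half the derivative of that value along \<open>tng\<close>.\<close>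
  define M :: "pt \<Rightarrow> pt" where
    "M z = s *\<^sub>R vector [(E + \<alpha>) * z $ 1 + (\<beta> - k) * z $ 2, (\<beta> + k) * z $ 1 + (E - \<alpha>) * z $ 2]" for z
  have trig: "cos (2 * \<theta>) = cos \<theta> * cos \<theta> - sin \<theta> * sin \<theta>" "sin (2 * \<theta>) = 2 * sin \<theta> * cos \<theta>"
    "sin \<theta> * sin \<theta> + cos \<theta> * cos \<theta> = 1" for \<theta> :: real
    using sin_cos_squared_add[of \<theta>] by (simp_all add: cos_double sin_double power2_eq_square)
  have Qdir: "Q (r *\<^sub>R dir \<theta>) = (r * y \<theta>)\<^sup>2" for r \<theta>
    unfolding power_mult_distrib y Q_def using trig[of \<theta>] by (simp add: dir_def) algebra
  have Mdir: "M (dir \<theta>) = y \<theta> *\<^sub>R (P \<theta> - m)" for \<theta>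
    unfolding P y pt_eq_iff using trig[of \<theta>] by (simp add: M_def dir_def tng_def) algebra
  have polar: "\<exists>r \<theta>. r > 0 \<and> z = r *\<^sub>R dir \<theta>" if "z \<noteq> 0" for z :: pt
  proof -
    obtain \<theta> where "sgn z = dir \<theta>" using dir_surj[of "sgn z"] \<open>z \<noteq> 0\<close> by (auto simp: norm_sgn)
    then have "z = norm z *\<^sub>R dir \<theta>" by (metis sgn_div_norm scaleR_scaleR right_inverse norm_eq_zero scaleR_one that)
    then show ?thesis using that by (intro exI[of _ "norm z"] exI[of _ \<theta>]) auto
  qed
  have Qpos: "Q z > 0" if "z \<noteq> 0" for z
  proof -
    obtain r \<theta> where "r > 0" "z = r *\<^sub>R dir \<theta>" using polar[OF \<open>z \<noteq> 0\<close>] by blast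
    then show ?thesis using Qdir[of r \<theta>] pos[of \<theta>] by simp
  qed
  define a where "a = E + \<alpha>"
  define D where "D = (E + \<alpha>) * (E - \<alpha>) - \<beta>\<^sup>2"
  have a: "a > 0" using Qpos[of "vector [1, 0]"] by (simp add: Q_def a_def pt_eq_iff)
  have D: "D > 0"
  proof -
    \<comment> \<open>For fixed second coordinate \<open>a\<close>, this vector minimizes
      \<open>Q\<close>, which leaves \<open>a\<close> times the determinant.\<close>
    have "Q (vector [- \<beta>, a]) = a * D" unfolding Q_def a_def D_def by simp algebra
    moreover have "vector [- \<beta>, a] \<noteq> (0::pt)" using a by (simp add: pt_eq_iff)
    ultimately show ?thesis using Qpos[of "vector [- \<beta>, a]"] a by (simp add: zero_less_mult_iff)
  qed
  define t1 where "t1 = sqrt a"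
  define t2 where "t2 = sqrt (D / a)"
  have t: "t1 > 0" "t2 > 0" "t1\<^sup>2 = a" "t2\<^sup>2 = D / a" using a D by (auto simp: t1_def t2_def)
  \<comment> \<open>The inverse of the Cholesky factor with rows \<open>(t1, \<beta> / t1)\<close>
    and \<open>(0, t2)\<close>; it maps the unit circle onto \<open>Q z = 1\<close>.\<close>
  define T :: "pt \<Rightarrow> pt" where "T e = vector [(e $ 1 - \<beta> / t1 * (e $ 2 / t2)) / t1, e $ 2 / t2]" for e
  have QT: "Q (T e) = (norm e)\<^sup>2" for e
  proof -
    define p where "p = (e $ 1 - \<beta> / t1 * (e $ 2 / t2)) / t1"
    define q where "q = e $ 2 / t2"
    have e1: "e $ 1 = t1 * p + \<beta> / t1 * q" and e2: "e $ 2 = t2 * q" using t by (simp_all add: p_def q_def)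
    have "(norm e)\<^sup>2 = (e $ 1)\<^sup>2 + (e $ 2)\<^sup>2"
      unfolding power2_norm_eq_inner inner_pt by (simp add: power2_eq_square)
    also have "\<dots> = t1\<^sup>2 * p\<^sup>2 + 2 * \<beta> * p * q + \<beta>\<^sup>2 / t1\<^sup>2 * q\<^sup>2 + t2\<^sup>2 * q\<^sup>2"
      unfolding e1 e2 using t(1) by (simp add: power2_sum power_mult_distrib power_divide)
    also have "\<dots> = a * p\<^sup>2 + 2 * \<beta> * p * q + (\<beta>\<^sup>2 + D) / a * q\<^sup>2"
      unfolding t(3,4) by (simp add: add_divide_distrib algebra_simps)
    also have "(\<beta>\<^sup>2 + D) / a = E - \<alpha>" using a by (simp add: D_def a_def)
    finally show ?thesis by (simp add: Q_def T_def p_def q_def a_def)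
  qed
  have linT: "linear T"
    by (rule linearI) (simp_all add: T_def pt_eq_iff algebra_simps add_divide_distrib diff_divide_distrib)
  have linM: "linear M"
    by (rule linearI) (simp_all add: M_def pt_eq_iff field_simps)
  have T0: "e = 0" if "T e = 0" for e using QT[of e] that by (simp add: Q_def)
  have M0: "z = 0" if "M z = 0" for z
  proof -
    have z: "(E + \<alpha>) * z $ 1 + (\<beta> - k) * z $ 2 = 0" "(\<beta> + k) * z $ 1 + (E - \<alpha>) * z $ 2 = 0"
      using that s by (auto simp: M_def pt_eq_iff)
    \<comment> \<open>Up to the square of \<open>s\<close>, the determinant of \<open>M\<close> is
      \<open>D + k\<^sup>2\<close>: the rotation part can only increase it.\<close>
    have "(D + k\<^sup>2) * z $ 1 = 0" "(D + k\<^sup>2) * z $ 2 = 0"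
      using z unfolding D_def by algebra+
    moreover have "D + k\<^sup>2 \<noteq> 0" using D zero_le_power2[of k] by linarith
    ultimately show ?thesis by (simp add: pt_eq_iff)
  qed
  show ?thesis
  proof (rule is_ellipseI[OF K, of "M \<circ> T" m])
    show lin: "linear (M \<circ> T)" using linT linM by (rule linear_compose)
    show "inj (M \<circ> T)"
      unfolding linear_injective_0[OF lin]
    proof (intro allI impI)
      fix e assume "(M \<circ> T) e = 0"
      then show "e = 0" using T0[of e] M0[of "T e"] by simp
    qed
    fix e :: pt assume e: "norm e = 1"
    then have "T e \<noteq> 0" using T0[of e] by auto
    then obtain r \<theta> where r: "r > 0" "T e = r *\<^sub>R dir \<theta>" using polar by blast
    \<comment> \<open>On the conic \<open>Q z = 1\<close> the radius in direction
      \<open>dir \<theta>\<close> is \<open>1 / y \<theta>\<close>, which cancels the factor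
      \<open>y \<theta>\<close> in \<open>Mdir\<close>.\<close>
    have "(r * y \<theta>)\<^sup>2 = 1" using QT[of e] Qdir[of r \<theta>] e r by simp
    then have "r * y \<theta> = 1" using r(1) pos[of \<theta>] by (simp add: power2_eq_1_iff mult_pos_pos less_imp_neq)
         (smt (verit) mult_pos_pos)
    then have "(M \<circ> T) e = P \<theta> - m"
      using r(2) linear_scale[OF linM] Mdir[of \<theta>] by (simp add: mult.commute)
    then show "m + (M \<circ> T) e \<in> frontier K" using fr[of \<theta>] by simp
  qed
qed

section \<open>The area of the illuminated region\<close>

context flotation
begin

definition tri :: "real \<Rightarrow> pt \<Rightarrow> pt set" where
  "tri \<theta> q = convex hull {pnt \<theta> (bm \<theta>), pnt \<theta> (bp \<theta>), q}"

lemma pt_height: "q = pnt \<theta> s + height \<theta> q *\<^sub>R dir \<theta> + (tng \<theta> \<bullet> q - s) *\<^sub>R tng \<theta>"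
proof -
  have "q = (dir \<theta> \<bullet> q) *\<^sub>R dir \<theta> + (tng \<theta> \<bullet> q) *\<^sub>R tng \<theta>" by (rule frame_expand[OF frame_dir])
  also have "\<dots> = pnt \<theta> s + height \<theta> q *\<^sub>R dir \<theta> + (tng \<theta> \<bullet> q - s) *\<^sub>R tng \<theta>"
    by (simp add: pnt_def height_def algebra_simps)
  finally show ?thesis .
qed

lemma pnt_diff: "pnt \<theta> t = pnt \<theta> s + (t - s) *\<^sub>R tng \<theta>"
  by (simp add: pnt_def algebra_simps)

lemma area_tri: "area (tri \<theta> q) = hw \<theta> * \<bar>height \<theta> q\<bar>"
proof -
  let ?z = "pnt \<theta> (bm \<theta>)"
  have 1: "pnt \<theta> (bp \<theta>) = ?z + 0 *\<^sub>R dir \<theta> + (2 * hw \<theta>) *\<^sub>R tng \<theta>"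
    using pnt_diff[of \<theta> "bp \<theta>" "bm \<theta>"] by (simp add: hw_def)
  have "tri \<theta> q = convex hull {?z, ?z + 0 *\<^sub>R dir \<theta> + (2 * hw \<theta>) *\<^sub>R tng \<theta>,
      ?z + height \<theta> q *\<^sub>R dir \<theta> + (tng \<theta> \<bullet> q - bm \<theta>) *\<^sub>R tng \<theta>}"
    unfolding tri_def 1 using pt_height[of q \<theta> "bm \<theta>"] by simp
  then have "area (tri \<theta> q) = \<bar>0 * (tng \<theta> \<bullet> q - bm \<theta>) - 2 * hw \<theta> * height \<theta> q\<bar> / 2"
    using area_triangle[OF frame_dir] by metis
  then show ?thesis using hw_pos[of \<theta>] by (simp add: abs_mult)
qed

lemma tri_subset_hull: "tri \<theta> q \<subseteq> convex hull (insert q K)"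
  unfolding tri_def by (rule hull_mono) (use chord_mem in auto)

lemma area_cap_h: "area (K \<inter> cap (dir \<theta>) (h \<theta>)) = \<delta>"
  unfolding h_def by (rule area_flot_level[OF K(1) \<delta>]) simp

lemma hull_Diff_lmeasurable: "convex hull (insert q K) - K \<in> lmeasurable"
  by (intro fmeasurable.Diff lmeasurable_compact compact_convex_hull compact_insert K)

text \<open>The triangle over the chord with apex \<open>q\<close> lies in the hull on the side of
  the cap, so its part inside \<open>K\<close> lies in the cap. The apex need not be a pole; this
  freedom later shows that no point of the illumination curve is higher than the pole.\<close>

lemma area_illuminated_ge:
  assumes "height \<theta> q > 0"
  shows "hw \<theta> * height \<theta> q - \<delta> \<le> area (convex hull (insert q K) - K)"
proof -
  let ?T = "tri \<theta> q" and ?C = "K \<inter> cap (dir \<theta>) (h \<theta>)"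
  have c: "compact ?T" "compact ?C" by (auto simp: tri_def compact_triangle compact_Int_cap K)
  have "?T \<subseteq> cap (dir \<theta>) (h \<theta>)"
    unfolding tri_def
    by (rule hull_minimal)
       (use assms in \<open>auto simp: cap_def dir_pnt height_def convex_halfspace_ge\<close>)
  then have "?T \<subseteq> (convex hull (insert q K) - K) \<union> ?C"
    using tri_subset_hull by blast
  then have "area ?T \<le> measure lebesgue ((convex hull (insert q K) - K) \<union> ?C)"
    unfolding area_def using c hull_Diff_lmeasurable
    by (intro measure_mono_fmeasurable) (auto simp: lmeasurable_compact fmeasurableD)
  also have "\<dots> \<le> area (convex hull (insert q K) - K) + area ?C"
    unfolding area_def using c hull_Diff_lmeasurable
    by (intro measure_Un_le) (auto simp: lmeasurable_compact fmeasurableD)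
  finally show ?thesis using assms by (simp add: area_tri area_cap_h)
qed

text \<open>The intersection of the supporting half-planes at the two endpoints. The inequality at
  \<open>bm\<close> is reversed because it was divided by a negative tangential component of the
  normal.\<close>

definition wedge :: "real \<Rightarrow> pt set" where
  "wedge \<theta> = {x. tng \<theta> \<bullet> x - bp \<theta> + slope bp \<theta> * height \<theta> x \<le> 0} \<inter>
             {x. tng \<theta> \<bullet> x - bm \<theta> + slope bm \<theta> * height \<theta> x \<ge> 0}"

lemma convex_wedge: "convex (wedge \<theta>)"
proof -
  have "wedge \<theta> = {x. (tng \<theta> + slope bp \<theta> *\<^sub>R dir \<theta>) \<bullet> x \<le> bp \<theta> + slope bp \<theta> * h \<theta>} \<inter>
      {x. (tng \<theta> + slope bm \<theta> *\<^sub>R dir \<theta>) \<bullet> x \<ge> bm \<theta> + slope bm \<theta> * h \<theta>}"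
    by (auto simp: wedge_def height_def inner_add_left algebra_simps)
  then show ?thesis by (simp add: convex_Int convex_halfspace_le convex_halfspace_ge)
qed

lemma K_subset_wedge: "K \<subseteq> wedge \<theta>"
proof
  fix x assume x: "x \<in> K"
  have exp: "normal K (pnt \<theta> s) \<bullet> (x - pnt \<theta> s) =
      height \<theta> x * (normal K (pnt \<theta> s) \<bullet> dir \<theta>) + (tng \<theta> \<bullet> x - s) * (normal K (pnt \<theta> s) \<bullet> tng \<theta>)" for s
  proof -
    have "x - pnt \<theta> s = height \<theta> x *\<^sub>R dir \<theta> + (tng \<theta> \<bullet> x - s) *\<^sub>R tng \<theta>"
      using pt_height[of x \<theta> s] by (metis add.assoc add_diff_cancel_left')
    then show ?thesis by (simp add: inner_add_right)
  qed
  have "normal K (pnt \<theta> (bp \<theta>)) \<bullet> (x - pnt \<theta> (bp \<theta>)) \<le> 0"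
       "normal K (pnt \<theta> (bm \<theta>)) \<bullet> (x - pnt \<theta> (bm \<theta>)) \<le> 0"
    using supports_normal[OF K(1) chord_frontier(1)] supports_normal[OF K(1) chord_frontier(2)] x
    by (auto simp: supports_def)
  then show "x \<in> wedge \<theta>"
    unfolding exp wedge_def slope_def using normal_tng_bp[of \<theta>] normal_tng_bm[of \<theta>]
    by (simp add: field_simps)
qed

lemma hull_subset_wedge:
  assumes "pole \<theta> p"
  shows "convex hull (insert p K) \<subseteq> wedge \<theta>"
  by (rule hull_minimal) (use K_subset_wedge convex_wedge pole_eqs[OF assms] in \<open>auto simp: wedge_def\<close>)

lemma wedge_subset_tri:
  assumes p: "pole \<theta> p" "height \<theta> p > 0" and x: "x \<in> wedge \<theta>" "height \<theta> x \<ge> 0"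
  shows "x \<in> tri \<theta> p"
proof -
  define y where "y = height \<theta> p"
  define \<xi> where "\<xi> = tng \<theta> \<bullet> p"
  define s where "s = tng \<theta> \<bullet> x"
  define l where "l = height \<theta> x / y"
  define w where "w = bp \<theta> - bm \<theta>"
  have w: "w > 0" using bm_less_bp[of \<theta>] by (simp add: w_def)
  have y: "y > 0" using p by (simp add: y_def)
  have hx: "height \<theta> x = l * y" using y by (simp add: l_def)
  have l: "l \<ge> 0" using x y by (simp add: l_def)
  have "slope bp \<theta> * y = bp \<theta> - \<xi>" "slope bm \<theta> * y = bm \<theta> - \<xi>"
    using pole_eqs[OF p(1)] by (auto simp: y_def \<xi>_def)
  moreover have "s - bp \<theta> + l * (slope bp \<theta> * y) \<le> 0" "s - bm \<theta> + l * (slope bm \<theta> * y) \<ge> 0"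
    using x(1) by (auto simp: wedge_def s_def hx algebra_simps)
  ultimately have b: "s - bp \<theta> + l * (bp \<theta> - \<xi>) \<le> 0" "s - bm \<theta> + l * (bm \<theta> - \<xi>) \<ge> 0" by auto
  \<comment> \<open>With \<open>l\<close> as the weight of the pole and \<open>m\<close> as that of
    the endpoint \<open>bp\<close>, the two wedge inequalities say exactly \<open>m \<ge> 0\<close>
    and \<open>m + l \<le> 1\<close>.\<close>
  define m where "m = (s - bm \<theta> - l * (\<xi> - bm \<theta>)) / w"
  have m: "m \<ge> 0" "m + l \<le> 1"
    using b w by (auto simp: m_def field_simps w_def)
  have s: "s - bm \<theta> = m * w + l * (\<xi> - bm \<theta>)" using w by (simp add: m_def)
  let ?A = "pnt \<theta> (bm \<theta>)"
  have B: "pnt \<theta> (bp \<theta>) - ?A = w *\<^sub>R tng \<theta>"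
    using pnt_diff[of \<theta> "bp \<theta>" "bm \<theta>"] by (simp add: w_def)
  have P: "p - ?A = y *\<^sub>R dir \<theta> + (\<xi> - bm \<theta>) *\<^sub>R tng \<theta>"
    using pt_height[of p \<theta> "bm \<theta>"] unfolding y_def \<xi>_def by (metis add.assoc add_diff_cancel_left')
  have "x = ?A + (l * y) *\<^sub>R dir \<theta> + (m * w + l * (\<xi> - bm \<theta>)) *\<^sub>R tng \<theta>"
    using pt_height[of x \<theta> "bm \<theta>"] unfolding hx s_def[symmetric] s .
  also have "\<dots> = ?A + m *\<^sub>R (pnt \<theta> (bp \<theta>) - ?A) + l *\<^sub>R (p - ?A)"
    unfolding B P by (simp add: algebra_simps)
  finally show ?thesis
    unfolding tri_def convex_hull_3_alt using m l by blast
qed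

text \<open>A segment from \<open>p\<close> to a point of \<open>K\<close> behind the line crosses
  the line within the wedge, hence in the chord. By convexity its remaining part behind the line
  lies in \<open>K\<close>.\<close>

lemma hull_Diff_subset_cap:
  assumes p: "pole \<theta> p" "height \<theta> p > 0"
  shows "convex hull (insert p K) - K \<subseteq> {x. height \<theta> x \<ge> 0}"
proof (rule subsetI, rule CollectI, rule ccontr)
  fix x assume x: "x \<in> convex hull (insert p K) - K" and "\<not> height \<theta> x \<ge> 0"
  then have hx: "height \<theta> x < 0" by simp
  have aff: "height \<theta> ((1 - t) *\<^sub>R k + t *\<^sub>R q) = (1 - t) * height \<theta> k + t * height \<theta> q" for t k q
    by (simp add: height_def inner_add_right algebra_simps)
  have "K \<noteq> {}" using K(5) interior_subset by auto
  then have "convex hull (insert p K) =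
      {x. \<exists>a\<ge>0. \<exists>b\<ge>0. \<exists>k. a + b = 1 \<and> k \<in> K \<and> x = a *\<^sub>R p + b *\<^sub>R k}"
    using convex_hull_insert[of K p] hull_same[of convex K] K(3) by simp
  then obtain t b k where tb: "0 \<le> t" "0 \<le> b" "t + b = 1" "k \<in> K" "x = t *\<^sub>R p + b *\<^sub>R k"
    using x by blast
  then have "b = 1 - t" by simp
  then have t: "0 \<le> t" "t \<le> 1" "k \<in> K" "x = (1 - t) *\<^sub>R k + t *\<^sub>R p"
    using tb by (auto simp: add.commute)
  have hk: "height \<theta> k < 0"
  proof (rule ccontr)
    assume "\<not> ?thesis"
    then have "height \<theta> x \<ge> 0" unfolding t(4) aff using t p by simp
    then show False using hx by simp
  qed
  \<comment> \<open>The zero of the height, which is affine along the segment from \<open>k\<close>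
    to \<open>p\<close>.\<close>
  define t' where "t' = - height \<theta> k / (height \<theta> p - height \<theta> k)"
  define w where "w = (1 - t') *\<^sub>R k + t' *\<^sub>R p"
  have t': "0 < t'" "t' < 1" using hk p by (auto simp: t'_def field_simps)
  have hw: "height \<theta> w = 0" unfolding w_def aff using hk p by (simp add: t'_def field_simps)
  have "w \<in> convex hull (insert p K)"
    unfolding w_def using t' t(3)
    by (intro convexD_alt[OF convex_convex_hull]) (auto intro: hull_inc)
  then have "w \<in> wedge \<theta>" using hull_subset_wedge[OF p(1)] by blast
  then have b: "bm \<theta> \<le> tng \<theta> \<bullet> w" "tng \<theta> \<bullet> w \<le> bp \<theta>" by (auto simp: wedge_def hw)
  have "w = pnt \<theta> (tng \<theta> \<bullet> w)" using pt_height[of w \<theta> "tng \<theta> \<bullet> w"] hw by simp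
  moreover have "pnt \<theta> (tng \<theta> \<bullet> w) \<in> K"
  proof (cases "tng \<theta> \<bullet> w = bm \<theta> \<or> tng \<theta> \<bullet> w = bp \<theta>")
    case True then show ?thesis using chord_mem by auto
  next
    case False
    then have "pnt \<theta> (tng \<theta> \<bullet> w) \<in> interior K" using b by (intro chord_interior_mem) auto
    then show ?thesis using interior_subset by blast
  qed
  ultimately have wK: "w \<in> K" by simp
  have "t < t'"
  proof (rule ccontr)
    assume "\<not> t < t'"
    then have "t' * (height \<theta> p - height \<theta> k) \<le> t * (height \<theta> p - height \<theta> k)"
      using hk p by (intro mult_right_mono) auto
    moreover have "t' * (height \<theta> p - height \<theta> k) = - height \<theta> k"
      using hk p by (simp add: t'_def)
    ultimately have "height \<theta> x \<ge> 0" unfolding t(4) aff by (simp add: algebra_simps)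
    then show False using hx by simp
  qed
  have "(1 - t / t') *\<^sub>R k + (t / t') *\<^sub>R w \<in> K"
    by (rule convexD_alt[OF K(3) t(3) wK]) (use t t' \<open>t < t'\<close> in auto)
  moreover have "(1 - t / t') *\<^sub>R k + (t / t') *\<^sub>R w = (1 - t / t' * t') *\<^sub>R k + (t / t' * t') *\<^sub>R p"
    unfolding w_def by (simp add: algebra_simps)
  ultimately have "x \<in> K" using t' t(4) by simp
  then show False using x by simp
qed

text \<open>For a pole the whole illuminated region lies in the triangle, and the triangle contains
  the cap, so the lower bound is attained.\<close>

lemma area_illuminated_le:
  assumes p: "pole \<theta> p" "height \<theta> p > 0"
  shows "area (convex hull (insert p K) - K) \<le> hw \<theta> * height \<theta> p - \<delta>"
proof -
  let ?T = "tri \<theta> p" and ?C = "K \<inter> cap (dir \<theta>) (h \<theta>)"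
  have c: "?T \<in> lmeasurable" "?C \<in> lmeasurable"
    by (auto simp: tri_def compact_triangle compact_Int_cap K intro!: lmeasurable_compact)
  have CT: "?C \<subseteq> ?T"
    using wedge_subset_tri[OF p] K_subset_wedge[of \<theta>] by (auto simp: cap_def height_def)
  have "convex hull (insert p K) - K \<subseteq> ?T - ?C"
    using hull_Diff_subset_cap[OF p] hull_subset_wedge[OF p(1)] wedge_subset_tri[OF p] by blast
  then have "area (convex hull (insert p K) - K) \<le> measure lebesgue (?T - ?C)"
    unfolding area_def using hull_Diff_lmeasurable c
    by (intro measure_mono_fmeasurable) (auto intro: fmeasurable.Diff)
  also have "\<dots> = area ?T - area ?C"
    unfolding area_def by (rule measurable_measure_Diff) (use c CT in auto)
  finally show ?thesis using p by (simp add: area_tri area_cap_h)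
qed

end

section \<open>Support functions and the theorem\<close>

context flotation
begin

lemma floating_envelope_eq: "floating_envelope K \<delta> = range (\<lambda>\<theta>. pnt \<theta> (mid \<theta>))"
proof -
  have d: "deriv h \<theta> = mid \<theta>" for \<theta>
    by (rule DERIV_imp_deriv[OF DERIV_h])
  have "x = pnt \<theta> (mid \<theta>)" if "dir \<theta> \<bullet> x = h \<theta>" "tng \<theta> \<bullet> x = mid \<theta>" for x \<theta>
    using frame_expand[OF frame_dir, of x \<theta>] that by (simp add: pnt_def)
  then show ?thesis
    unfolding floating_envelope_def vector_derivative_dir h_def[symmetric] d
    using dir_pnt by fastforce
qed

text \<open>Everything depends on the angle only through the frame; this supplies the periodicity of
  the envelope.\<close>

lemma pnt_mid_cong:
  assumes "dir \<phi> = dir \<psi>" "tng \<phi> = tng \<psi>"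
  shows "pnt \<phi> (mid \<phi>) = pnt \<psi> (mid \<psi>)"
  using assms by (simp add: pnt_def mid_def bp_def bm_def h_def)

text \<open>The case of poles on the side of the cap; the opposite case reduces to it by
  complementation.\<close>

context
  assumes pole_exists: "\<And>\<theta>. \<exists>p. pole \<theta> p"
    and height_pos: "\<And>\<theta> p. pole \<theta> p \<Longrightarrow> height \<theta> p > 0"
begin

lemma envelope_curvature_pos: "hw \<theta> * (slope bp \<theta> - slope bm \<theta>) / 2 > 0"
proof -
  obtain p where p: "pole \<theta> p" using pole_exists by blast
  then have "(slope bp \<theta> - slope bm \<theta>) * height \<theta> p > 0"
    using slope_diff_height[OF p] hw_pos[of \<theta>] by simp
  then show ?thesis using height_pos[OF p] hw_pos[of \<theta>] by (simp add: zero_less_mult_iff)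
qed

text \<open>As \<open>\<phi>\<close> varies, the left side has derivative minus the positive
  curvature radius times \<open>sin (\<phi> - \<theta>)\<close>. It falls for half a turn from
  \<open>\<theta>\<close> and then rises back, so its maximum is at \<open>\<theta>\<close>, with
  value \<open>h \<theta>\<close>.\<close>

lemma envelope_support: "dir \<theta> \<bullet> pnt \<phi> (mid \<phi>) \<le> h \<theta>"
proof -
  define g where "g \<phi> = dir \<theta> \<bullet> pnt \<phi> (mid \<phi>)" for \<phi>
  have g: "g = (\<lambda>\<phi>. h \<phi> * cos (\<phi> - \<theta>) - mid \<phi> * sin (\<phi> - \<theta>))"
    by (simp add: fun_eq_iff g_def pnt_def inner_add_right dir_inner_dir)
  define \<rho> where "\<rho> \<phi> = hw \<phi> * (slope bp \<phi> - slope bm \<phi>) / 2" for \<phi>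
  have dg: "(g has_real_derivative - \<rho> \<phi> * sin (\<phi> - \<theta>)) (at \<phi>)" for \<phi>
    unfolding g
    by (rule derivative_eq_intros DERIV_h DERIV_mid refl | simp)+
       (simp add: \<rho>_def algebra_simps)
  have \<rho>: "\<rho> \<phi> > 0" for \<phi> unfolding \<rho>_def by (rule envelope_curvature_pos)
  have down: "g (\<theta> + t) \<le> g \<theta>" if "0 \<le> t" "t \<le> pi" for t
  proof (rule DERIV_nonpos_imp_nonincreasing[of \<theta> "\<theta> + t" g])
    fix x assume "\<theta> \<le> x" "x \<le> \<theta> + t"
    then have "sin (x - \<theta>) \<ge> 0" using that by (intro sin_ge_zero) auto
    then show "\<exists>y. (g has_real_derivative y) (at x) \<and> y \<le> 0"
      using dg[of x] \<rho>[of x] by (intro exI[of _ "- \<rho> x * sin (x - \<theta>)"]) auto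
  qed (use that in auto)
  have up: "g (\<theta> + t) \<le> g (\<theta> + 2 * pi)" if "pi \<le> t" "t \<le> 2 * pi" for t
  proof (rule DERIV_nonneg_imp_nondecreasing[of "\<theta> + t" "\<theta> + 2 * pi" g])
    fix x assume "\<theta> + t \<le> x" "x \<le> \<theta> + 2 * pi"
    then have "sin (x - \<theta>) \<le> 0"
      using that by (cases "x - \<theta> = 2 * pi") (auto intro!: sin_le_zero)
    then show "\<exists>y. (g has_real_derivative y) (at x) \<and> 0 \<le> y"
      using dg[of x] \<rho>[of x] by (intro exI[of _ "- \<rho> x * sin (x - \<theta>)"]) (auto simp: mult_le_0_iff)
  qed (use that in auto)
  have per: "g (\<theta> + 2 * pi) = g \<theta>"
    unfolding g_def by (simp add: pnt_mid_cong[OF dir_periodic])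
  have g\<theta>: "g \<theta> = h \<theta>" by (simp add: g)
  obtain t where t: "0 \<le> t" "t < 2 * pi" "cos (\<phi> - \<theta>) = cos t" "sin (\<phi> - \<theta>) = sin t"
    using sincos_total_2pi[of "cos (\<phi> - \<theta>)" "sin (\<phi> - \<theta>)"] by (metis sin_cos_squared_add2)
  have "dir \<phi> = dir (\<theta> + t)" "tng \<phi> = tng (\<theta> + t)"
  proof -
    have "\<phi> = \<theta> + (\<phi> - \<theta>)" by simp
    then have "cos \<phi> = cos (\<theta> + t)" "sin \<phi> = sin (\<theta> + t)"
      using t by (metis cos_add, metis sin_add)
    then show "dir \<phi> = dir (\<theta> + t)" "tng \<phi> = tng (\<theta> + t)" by (simp_all add: dir_def tng_def)
  qed
  then have "g \<phi> = g (\<theta> + t)" unfolding g_def using pnt_mid_cong[of \<phi> "\<theta> + t"] by simp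
  then have "g \<phi> \<le> h \<theta>" using t(1,2) per g\<theta> down[of t] up[of t] by (cases "t \<le> pi") auto
  then show ?thesis by (simp add: g_def)
qed

lemma ellipse_of_homothetic:
  assumes illum: "illumination_curve K d = {p. \<exists>\<theta>. pole \<theta> p}"
    and hom: "homothetic (floating_envelope K \<delta>) (illumination_curve K d)"
  shows "is_ellipse K"
proof -
  have area_pole: "area (convex hull (insert p K) - K) = d" if "pole \<theta> p" for \<theta> p
    using that illum by (auto simp: illumination_curve_def)
  \<comment> \<open>The area of the triangle over any chord: the cap together with the illuminated
    region.\<close>
  define k where "k = \<delta> + d"
  have k: "hw \<theta> * height \<theta> p = k" if "pole \<theta> p" for \<theta> p
    using area_illuminated_ge[OF height_pos[OF that]] area_illuminated_le[OF that height_pos[OF that]]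
      area_pole[OF that] by (simp add: k_def)
  define y where "y \<theta> = k / hw \<theta>" for \<theta>
  have hp: "height \<theta> p = y \<theta>" if "pole \<theta> p" for \<theta> p
    using k[OF that] hw_pos[of \<theta>] by (simp add: y_def field_simps)
  have ypos: "y \<theta> > 0" for \<theta> using pole_exists[of \<theta>] hp height_pos by metis
  \<comment> \<open>A higher point would span with the same chord a triangle of area more than
    \<open>k\<close>, and so would illuminate more than \<open>d\<close>.\<close>
  have sup: "height \<theta> q \<le> y \<theta>" if "q \<in> illumination_curve K d" for q \<theta>
  proof (rule ccontr)
    assume "\<not> ?thesis"
    then have gt: "height \<theta> q > y \<theta>" by simp
    then have "hw \<theta> * height \<theta> q - \<delta> \<le> d"
      using area_illuminated_ge[of \<theta> q] ypos[of \<theta>] that by (auto simp: illumination_curve_def)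
    moreover have "hw \<theta> * height \<theta> q > hw \<theta> * y \<theta>" using gt hw_pos[of \<theta>] by simp
    moreover have "hw \<theta> * y \<theta> = k" using hw_pos[of \<theta>] by (simp add: y_def)
    ultimately show False by (simp add: k_def)
  qed
  obtain q c where c: "c > 0" and hc: "illumination_curve K d = (\<lambda>x. q + c *\<^sub>R (x - q)) ` range (\<lambda>\<theta>. pnt \<theta> (mid \<theta>))"
    using hom unfolding homothetic_def floating_envelope_eq by blast
  define w where "w = (1 - c) *\<^sub>R q"
  have hc: "illumination_curve K d = range (\<lambda>\<theta>. w + c *\<^sub>R pnt \<theta> (mid \<theta>))"
    unfolding hc w_def image_image by (simp add: algebra_simps)
  \<comment> \<open>Both sides, increased by \<open>h\<close>, are the support function of the
    illumination curve: once computed from the poles, once from the homothetic image of the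
    envelope.\<close>
  have y_eq: "y \<theta> = (c - 1) * h \<theta> + dir \<theta> \<bullet> w" for \<theta>
  proof (rule antisym)
    obtain p where p: "pole \<theta> p" using pole_exists by blast
    then have "p \<in> illumination_curve K d" using illum by blast
    then obtain \<phi> where "p = w + c *\<^sub>R pnt \<phi> (mid \<phi>)" using hc by blast
    then have "dir \<theta> \<bullet> p \<le> dir \<theta> \<bullet> w + c * h \<theta>"
      using envelope_support[of \<theta> \<phi>] c by (simp add: inner_add_right)
    then show "y \<theta> \<le> (c - 1) * h \<theta> + dir \<theta> \<bullet> w"
      using hp[OF p] by (simp add: height_def algebra_simps)
    have "w + c *\<^sub>R pnt \<theta> (mid \<theta>) \<in> illumination_curve K d" using hc by blast
    from sup[OF this, of \<theta>] show "(c - 1) * h \<theta> + dir \<theta> \<bullet> w \<le> y \<theta>"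
      by (simp add: height_def inner_add_right dir_pnt algebra_simps)
  qed
  have c1: "c \<noteq> 1"
  proof
    assume "c = 1"
    then have "y (0 + pi) = - y 0" unfolding y_eq dir_pi by simp
    then show False using ypos[of 0] ypos[of "0 + pi"] by linarith
  qed
  define y1 where "y1 \<theta> = (c - 1) * mid \<theta> + tng \<theta> \<bullet> w" for \<theta>
  have dy: "(y has_real_derivative y1 \<theta>) (at \<theta>)" for \<theta>
  proof -
    have "y = (\<lambda>\<theta>. (c - 1) * h \<theta> + dir \<theta> \<bullet> w)" using y_eq by blast
    then show ?thesis unfolding y1_def by (auto intro!: derivative_eq_intros DERIV_h DERIV_dir_inner)
  qed
  \<comment> \<open>In \<open>y'' + y = (c - 1) * (h + h'')\<close> the curvature radius is
    \<open>(hw \<theta>)\<^sup>2 / y \<theta>\<close>, and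
    \<open>hw \<theta> = k / y \<theta>\<close>.\<close>
  define \<kappa> where "\<kappa> = (c - 1) * k\<^sup>2"
  have dy1: "(y1 has_real_derivative - y \<theta> + \<kappa> / (y \<theta>) ^ 3) (at \<theta>)" for \<theta>
  proof -
    have "(y1 has_real_derivative (c - 1) * (- h \<theta> + hw \<theta> * (slope bp \<theta> - slope bm \<theta>) / 2)
        + - (dir \<theta> \<bullet> w)) (at \<theta>)"
      unfolding y1_def by (intro DERIV_add DERIV_cmult DERIV_mid DERIV_dir_inner)
    moreover have "hw \<theta> * (slope bp \<theta> - slope bm \<theta>) / 2 = k\<^sup>2 / (y \<theta>) ^ 3"
    proof -
      obtain p where p: "pole \<theta> p" using pole_exists by blast
      have "(slope bp \<theta> - slope bm \<theta>) * y \<theta> = 2 * hw \<theta>"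
        using slope_diff_height[OF p] hp[OF p] by simp
      moreover have "hw \<theta> = k / y \<theta>" using hw_pos[of \<theta>] ypos[of \<theta>] by (simp add: y_def field_simps)
      ultimately have "slope bp \<theta> - slope bm \<theta> = 2 * (k / y \<theta>) / y \<theta>"
        using ypos[of \<theta>] by (simp add: field_simps)
      then show ?thesis
        unfolding \<open>hw \<theta> = k / y \<theta>\<close> by (simp add: power2_eq_square power3_eq_cube)
    qed
    moreover have "(c - 1) * (- h \<theta> + k\<^sup>2 / (y \<theta>) ^ 3) + - (dir \<theta> \<bullet> w) = - y \<theta> + \<kappa> / (y \<theta>) ^ 3"
      unfolding \<kappa>_def using y_eq[of \<theta>] by (simp add: algebra_simps)
    ultimately show ?thesis by simp
  qed
  obtain E \<alpha> \<beta> where Y: "\<And>\<theta>. (y \<theta>)\<^sup>2 = E + \<alpha> * cos (2 * \<theta>) + \<beta> * sin (2 * \<theta>)"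
    and YY: "\<And>\<theta>. y \<theta> * y1 \<theta> = - \<alpha> * sin (2 * \<theta>) + \<beta> * cos (2 * \<theta>)"
    using ermakov_solution[OF ypos dy dy1] by blast
  \<comment> \<open>The center that absorbs \<open>w\<close>, so that
    \<open>(c - 1) *\<^sub>R (P - m)\<close> equals \<open>(c - 1) *\<^sub>R P + w\<close>; its
    coordinate along \<open>dir \<theta>\<close> is then \<open>y \<theta>\<close> for every point
    \<open>P\<close> of the chord.\<close>
  define m where "m = (- 1 / (c - 1)) *\<^sub>R w"
  show ?thesis
  proof (rule is_ellipse_from_quadratic_form[OF K(2,3) ypos chord_frontier(1) Y])
    show "1 / (c - 1) \<noteq> 0" using c1 by simp
    fix \<theta>
    have w: "w = (dir \<theta> \<bullet> w) *\<^sub>R dir \<theta> + (tng \<theta> \<bullet> w) *\<^sub>R tng \<theta>" by (rule frame_expand[OF frame_dir])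
    have bp: "bp \<theta> = mid \<theta> + hw \<theta>" by (simp add: mid_def hw_def field_simps)
    have "(c - 1) *\<^sub>R (pnt \<theta> (bp \<theta>) - m) = (c - 1) *\<^sub>R pnt \<theta> (bp \<theta>) + w"
      using c1 by (simp add: m_def scaleR_add_right)
    also have "\<dots> = (c - 1) *\<^sub>R pnt \<theta> (bp \<theta>) + ((dir \<theta> \<bullet> w) *\<^sub>R dir \<theta> + (tng \<theta> \<bullet> w) *\<^sub>R tng \<theta>)"
      using w by simp
    also have "\<dots> = y \<theta> *\<^sub>R dir \<theta> + (y1 \<theta> + (c - 1) * hw \<theta>) *\<^sub>R tng \<theta>"
      unfolding y_eq y1_def bp by (simp add: pnt_def algebra_simps)
    finally have "y \<theta> *\<^sub>R (c - 1) *\<^sub>R (pnt \<theta> (bp \<theta>) - m)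
        = y \<theta> *\<^sub>R (y \<theta> *\<^sub>R dir \<theta> + (y1 \<theta> + (c - 1) * hw \<theta>) *\<^sub>R tng \<theta>)" by simp
    also have "\<dots> = (y \<theta>)\<^sup>2 *\<^sub>R dir \<theta> + (y \<theta> * y1 \<theta> + (c - 1) * (y \<theta> * hw \<theta>)) *\<^sub>R tng \<theta>"
      by (simp add: algebra_simps power2_eq_square)
    also have "y \<theta> * hw \<theta> = k" using hw_pos[of \<theta>] by (simp add: y_def)
    finally have eq: "(c - 1) *\<^sub>R (y \<theta> *\<^sub>R (pnt \<theta> (bp \<theta>) - m)) =
        (y \<theta>)\<^sup>2 *\<^sub>R dir \<theta> + (- \<alpha> * sin (2 * \<theta>) + \<beta> * cos (2 * \<theta>) + (c - 1) * k) *\<^sub>R tng \<theta>"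
      unfolding YY by (simp add: mult.commute)
    have "y \<theta> *\<^sub>R (pnt \<theta> (bp \<theta>) - m) = (1 / (c - 1)) *\<^sub>R ((c - 1) *\<^sub>R (y \<theta> *\<^sub>R (pnt \<theta> (bp \<theta>) - m)))"
      using c1 by simp
    then show "y \<theta> *\<^sub>R (pnt \<theta> (bp \<theta>) - m) = (1 / (c - 1)) *\<^sub>R
        ((y \<theta>)\<^sup>2 *\<^sub>R dir \<theta> + (- \<alpha> * sin (2 * \<theta>) + \<beta> * cos (2 * \<theta>) + (c - 1) * k) *\<^sub>R tng \<theta>)"
      unfolding eq .
  qed
qed

end

end

text \<open>The line cutting off the complementary area with normal \<open>dir \<theta>\<close> is
  the original line with the opposite normal. Chords and poles are the same, while levels and
  heights change sign.\<close>

lemma flotation_complement: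
  assumes "flotation K \<delta>"
  shows "flotation K (area K - \<delta>)"
    and "flotation.h K (area K - \<delta>) \<theta> = - flotation.h K \<delta> (\<theta> + pi)"
    and "flotation.pole K (area K - \<delta>) \<theta> p \<longleftrightarrow> flotation.pole K \<delta> (\<theta> + pi) p"
    and "flotation.height K (area K - \<delta>) \<theta> p = - flotation.height K \<delta> (\<theta> + pi) p"
    and "floating_envelope K (area K - \<delta>) = floating_envelope K \<delta>"
proof -
  interpret F: flotation K \<delta> by fact
  interpret G: flotation K "area K - \<delta>"
    using F.smooth F.\<delta> by unfold_locales auto
  show "flotation K (area K - \<delta>)" by (rule G.flotation_axioms)
  have lev: "flot_level K (area K - \<delta>) (dir \<theta>) = - flot_level K \<delta> (dir (\<theta> + pi))" for \<theta>
    using flot_level_uminus[OF F.K(1) F.\<delta>, of "dir (\<theta> + pi)"] by (simp add: dir_pi)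
  then show h: "G.h \<theta> = - F.h (\<theta> + pi)" for \<theta> by (simp add: G.h_def F.h_def)
  have "flot_line K (area K - \<delta>) (dir \<theta>) = flot_line K \<delta> (dir (\<theta> + pi))"
    unfolding flot_line_def lev by (auto simp: dir_pi)
  then show "G.pole \<theta> p \<longleftrightarrow> F.pole (\<theta> + pi) p"
    by (simp add: G.pole_def F.pole_def)
  show "G.height \<theta> p = - F.height (\<theta> + pi) p"
    by (simp add: G.height_def F.height_def h dir_pi)
  \<comment> \<open>Since both midpoints are derivatives of levels, uniqueness of the derivative
    replaces a comparison of endpoints.\<close>
  have mid: "G.mid \<theta> = - F.mid (\<theta> + pi)" for \<theta>
  proof (rule DERIV_unique[OF G.DERIV_h])
    have "((\<lambda>\<phi>. F.h (\<phi> + pi)) has_real_derivative F.mid (\<theta> + pi)) (at \<theta>)"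
      using F.DERIV_h[of "\<theta> + pi"] by (simp add: DERIV_shift)
    then have "((\<lambda>\<phi>. - F.h (\<phi> + pi)) has_real_derivative - F.mid (\<theta> + pi)) (at \<theta>)"
      by (rule DERIV_minus)
    moreover have "G.h = (\<lambda>\<phi>. - F.h (\<phi> + pi))" using h by blast
    ultimately show "(G.h has_real_derivative - F.mid (\<theta> + pi)) (at \<theta>)" by simp
  qed
  have pnt: "G.pnt \<theta> (G.mid \<theta>) = F.pnt (\<theta> + pi) (F.mid (\<theta> + pi))" for \<theta>
    by (simp add: G.pnt_def F.pnt_def h mid dir_pi)
  have "range (\<lambda>\<theta>. F.pnt (\<theta> + pi) (F.mid (\<theta> + pi))) = range (\<lambda>\<theta>. F.pnt \<theta> (F.mid \<theta>))"
    by (auto simp: image_iff) (metis diff_add_cancel)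
  then show "floating_envelope K (area K - \<delta>) = floating_envelope K \<delta>"
    by (simp add: F.floating_envelope_eq G.floating_envelope_eq pnt)
qed

theorem theorem4p10:
  fixes K :: "pt set" and \<delta> \<delta>h :: real
  assumes "convex_body K" and "C2_boundary K"
    and "0 < \<delta>" and "\<delta> < area K"
    and "\<delta>h > 0"
    and "\<forall>\<xi>. norm \<xi> = 1 \<longrightarrow> (\<exists>p. is_pole K (flot_line K \<delta> \<xi>) p)"
    and "illumination_curve K \<delta>h =
           {p. \<exists>\<xi>. norm \<xi> = 1 \<and> is_pole K (flot_line K \<delta> \<xi>) p}"
    and "homothetic (floating_envelope K \<delta>) (centroid_curve K \<delta>)"
    and "homothetic (floating_envelope K \<delta>) (illumination_curve K \<delta>h)"
    and "homothetic (centroid_curve K \<delta>) (illumination_curve K \<delta>h)"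
  shows "is_ellipse K"
proof -
  interpret F: flotation K \<delta>
    using assms C2_boundary_imp_smooth_body by unfold_locales auto
  interpret G: flotation K "area K - \<delta>"
    by (rule flotation_complement[OF F.flotation_axioms])
  note compl = flotation_complement[OF F.flotation_axioms]
  have ex: "\<exists>p. F.pole \<theta> p" for \<theta> using assms(6) by (simp add: F.pole_def)
  have ill: "illumination_curve K \<delta>h = {p. \<exists>\<theta>. F.pole \<theta> p}"
    unfolding assms(7) F.pole_def using dir_surj frame_dir_simps(5) by metis
  from F.height_sign_cases[OF ex] show ?thesis
  proof
    assume "\<forall>\<theta> p. F.pole \<theta> p \<longrightarrow> F.height \<theta> p > 0"
    then show ?thesis using F.ellipse_of_homothetic[OF ex _ ill assms(9)] by blast
  next
    assume neg: "\<forall>\<theta> p. F.pole \<theta> p \<longrightarrow> F.height \<theta> p < 0"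
    have "{p. \<exists>\<theta>. F.pole \<theta> p} = {p. \<exists>\<theta>. G.pole \<theta> p}"
      unfolding compl(3) by (metis diff_add_cancel)
    then have ill': "illumination_curve K \<delta>h = {p. \<exists>\<theta>. G.pole \<theta> p}" using ill by simp
    have "\<exists>p. G.pole \<theta> p" for \<theta> unfolding compl(3) by (rule ex)
    moreover have "G.height \<theta> p > 0" if "G.pole \<theta> p" for \<theta> p
      using neg that by (simp add: compl(3,4))
    ultimately show ?thesis
      using G.ellipse_of_homothetic[OF _ _ ill'] assms(9) compl(5) by simp
  qed
qed

end
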